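(* There exist an irreducible Stein curve $X$ (that is, an irreducible, one-dimensional, reduced Stein complex space, countable at infinity) and a continuous function $f : X \to \mathbb{C}$ such that $f$ is holomorphic on $X \setminus f^{-1}(0)$, but for no $n \in \mathbb{N} = \{1,2,\ldots\}$ is the power $f^n$ holomorphic on all of $X$.
   Context: Complex spaces are assumed to be reduced and countable at infinity; they may be singular, and are not assumed to be normal. A function on an open subset $U$ of a reduced complex space $X$ is holomorphic if it is a section over $U$ of the structure sheaf $\mathcal{O}_X$ (equivalently, locally in an embedding of $X$ as an analytic subset of an open set of some $\mathbb{C}^m$, it is the restriction of a holomorphic function on the ambient open set). A continuous function $f$ is "holomorphic off its zero set" if its restriction to the open set $X \setminus f^{-1}(0)$ is holomorphic. Here $\mathbb{N} = \{1,2,\ldots\}$. *)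

theory Defs
  imports "HOL-Analysis.Analysis"
begin

text \<open>
  The dimension \<open>m\<close> of a local model varies from point to point, so \<open>\<complex>\<^sup>m\<close> is realised inside
  \<^typ>\<open>nat \<Rightarrow> complex\<close>, in the same way as \<^const>\<open>Euclidean_space\<close> realises \<open>\<real>\<^sup>m\<close>.
\<close>

definition Complex_space :: "nat \<Rightarrow> (nat \<Rightarrow> complex) topology" where
  "Complex_space m = subtopology (product_topology (\<lambda>_. euclidean) UNIV) {z. \<forall>i\<ge>m. z i = 0}"

text \<open>
  Holomorphic functions on an open set \<open>U\<close> of \<open>\<complex>\<^sup>m\<close>: total complex differentiability at every
  point. Only the values on \<open>U\<close> matter.
\<close>

definition holo :: "nat \<Rightarrow> (nat \<Rightarrow> complex) set \<Rightarrow> ((nat \<Rightarrow> complex) \<Rightarrow> complex) set" where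
  "holo m U = {F. \<forall>z\<in>U. \<exists>a :: nat \<Rightarrow> complex.
     ((\<lambda>w. (F w - F z - (\<Sum>i<m. a i * (w i - z i)))
            / complex_of_real (L2_set (\<lambda>i. cmod (w i - z i)) {..<m})) \<longlongrightarrow> 0) (at z within U)}"

text \<open>
  The structure sheaf of a reduced complex space is a subsheaf of the sheaf of continuous functions.
  Throughout, a sheaf of functions on a topological space \<open>X\<close> is a map \<open>\<O>\<close> sending an open set \<open>U\<close>
  to its set of sections, a section over \<open>U\<close> being represented by any total function with the
  right values on \<open>U\<close>. The values of \<open>\<O>\<close> at non-open sets are irrelevant.
\<close>

definition function_sheaf :: "'a topology \<Rightarrow> ('a set \<Rightarrow> ('a \<Rightarrow> complex) set) \<Rightarrow> bool" where
  "function_sheaf X \<O> \<longleftrightarrow>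
     (\<forall>U f g. openin X U \<and> f \<in> \<O> U \<and> (\<forall>x\<in>U. g x = f x) \<longrightarrow> g \<in> \<O> U) \<and>
     (\<forall>U V f. openin X U \<and> openin X V \<and> V \<subseteq> U \<and> f \<in> \<O> U \<longrightarrow> f \<in> \<O> V) \<and>
     (\<forall>\<U> f. (\<forall>U\<in>\<U>. openin X U \<and> f \<in> \<O> U) \<longrightarrow> f \<in> \<O> (\<Union>\<U>))"

definition analytic_subset ::
  "'a topology \<Rightarrow> ('a set \<Rightarrow> ('a \<Rightarrow> complex) set) \<Rightarrow> 'a set \<Rightarrow> bool" where
  "analytic_subset X \<O> A \<longleftrightarrow> A \<subseteq> topspace X \<and>
     (\<forall>p\<in>topspace X. \<exists>V F. openin X V \<and> p \<in> V \<and> finite F \<and> F \<subseteq> \<O> V \<and>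
        A \<inter> V = {x\<in>V. \<forall>f\<in>F. f x = 0})"

text \<open>
  Sections over \<open>V\<close> of the reduced structure sheaf of an analytic subset \<open>A\<close> of an open set of
  \<open>\<complex>\<^sup>m\<close>, where \<open>V\<close> is relatively open in \<open>A\<close>. As \<open>V\<close> is open in \<open>A\<close>, the set \<open>N \<inter> V\<close> below is a
  neighbourhood of \<open>p\<close> in \<open>A\<close>.
\<close>

definition model_sections :: "nat \<Rightarrow> (nat \<Rightarrow> complex) set \<Rightarrow> ((nat \<Rightarrow> complex) \<Rightarrow> complex) set" where
  "model_sections m V = {h. \<forall>p\<in>V. \<exists>N F. openin (Complex_space m) N \<and> p \<in> N \<and> F \<in> holo m N \<and>
     (\<forall>q\<in>N \<inter> V. h q = F q)}"

definition local_embedding ::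
  "'a topology \<Rightarrow> ('a set \<Rightarrow> ('a \<Rightarrow> complex) set) \<Rightarrow> 'a set \<Rightarrow> nat \<Rightarrow> (nat \<Rightarrow> complex) set \<Rightarrow>
   (nat \<Rightarrow> complex) set \<Rightarrow> ('a \<Rightarrow> nat \<Rightarrow> complex) \<Rightarrow> bool" where
  "local_embedding X \<O> U m D A \<phi> \<longleftrightarrow>
     openin X U \<and> openin (Complex_space m) D \<and>
     analytic_subset (subtopology (Complex_space m) D) (holo m) A \<and>
     homeomorphic_map (subtopology X U) (subtopology (Complex_space m) A) \<phi> \<and>
     (\<forall>W g. openin X W \<and> W \<subseteq> U \<longrightarrow>
        (g \<in> \<O> W \<longleftrightarrow> (\<exists>h\<in>model_sections m (\<phi> ` W). \<forall>x\<in>W. g x = h (\<phi> x))))"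

definition reduced_complex_space ::
  "'a topology \<Rightarrow> ('a set \<Rightarrow> ('a \<Rightarrow> complex) set) \<Rightarrow> bool" where
  "reduced_complex_space X \<O> \<longleftrightarrow> Hausdorff_space X \<and> function_sheaf X \<O> \<and>
     (\<forall>x\<in>topspace X. \<exists>U m D A \<phi>. x \<in> U \<and> local_embedding X \<O> U m D A \<phi>)"

definition countable_at_infinity :: "'a topology \<Rightarrow> bool" where
  "countable_at_infinity X \<longleftrightarrow>
     (\<exists>K :: nat \<Rightarrow> 'a set. (\<forall>n. compactin X (K n)) \<and> (\<Union>n. K n) = topspace X)"

definition irreducible_space ::
  "'a topology \<Rightarrow> ('a set \<Rightarrow> ('a \<Rightarrow> complex) set) \<Rightarrow> bool" where
  "irreducible_space X \<O> \<longleftrightarrow> topspace X \<noteq> {} \<and>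
     (\<forall>A B. analytic_subset X \<O> A \<and> analytic_subset X \<O> B \<and> A \<union> B = topspace X \<longrightarrow>
        A = topspace X \<or> B = topspace X)"

text \<open>
  The dimension at \<open>x\<close> is the least number of holomorphic functions near \<open>x\<close> having \<open>x\<close> as an
  isolated common zero.
\<close>

definition local_dim :: "'a topology \<Rightarrow> ('a set \<Rightarrow> ('a \<Rightarrow> complex) set) \<Rightarrow> 'a \<Rightarrow> nat" where
  "local_dim X \<O> x = (LEAST k. \<exists>U F. openin X U \<and> finite F \<and> card F = k \<and> F \<subseteq> \<O> U \<and>
     {y\<in>U. \<forall>f\<in>F. f y = 0} = {x})"

definition complex_dim :: "'a topology \<Rightarrow> ('a set \<Rightarrow> ('a \<Rightarrow> complex) set) \<Rightarrow> enat" where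
  "complex_dim X \<O> = (SUP x\<in>topspace X. enat (local_dim X \<O> x))"

text \<open>
  The supremum is taken in the extended reals, so that the hull of the empty set is empty.
\<close>

definition holomorphic_hull ::
  "'a topology \<Rightarrow> ('a set \<Rightarrow> ('a \<Rightarrow> complex) set) \<Rightarrow> 'a set \<Rightarrow> 'a set" where
  "holomorphic_hull X \<O> K =
     {x\<in>topspace X. \<forall>f\<in>\<O> (topspace X). ereal (cmod (f x)) \<le> (SUP y\<in>K. ereal (cmod (f y)))}"

definition holomorphically_convex ::
  "'a topology \<Rightarrow> ('a set \<Rightarrow> ('a \<Rightarrow> complex) set) \<Rightarrow> bool" where
  "holomorphically_convex X \<O> \<longleftrightarrow> (\<forall>K. compactin X K \<longrightarrow> compactin X (holomorphic_hull X \<O> K))"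

definition holomorphically_separable ::
  "'a topology \<Rightarrow> ('a set \<Rightarrow> ('a \<Rightarrow> complex) set) \<Rightarrow> bool" where
  "holomorphically_separable X \<O> \<longleftrightarrow>
     (\<forall>x\<in>topspace X. \<forall>y\<in>topspace X. x \<noteq> y \<longrightarrow> (\<exists>f\<in>\<O> (topspace X). f x \<noteq> f y))"

definition stein_space :: "'a topology \<Rightarrow> ('a set \<Rightarrow> ('a \<Rightarrow> complex) set) \<Rightarrow> bool" where
  "stein_space X \<O> \<longleftrightarrow> reduced_complex_space X \<O> \<and> countable_at_infinity X \<and>
     holomorphically_convex X \<O> \<and> holomorphically_separable X \<O>"

text \<open>
  A complex space that is countable at infinity has at most continuum many points. Hence, for
  existence statements, it is no restriction to take points from the type \<^typ>\<open>complex\<close>, with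
  arbitrary carrier and arbitrary topology.
\<close>

definition irreducible_stein_curve ::
  "'a topology \<Rightarrow> ('a set \<Rightarrow> ('a \<Rightarrow> complex) set) \<Rightarrow> bool" where
  "irreducible_stein_curve X \<O> \<longleftrightarrow>
     stein_space X \<O> \<and> irreducible_space X \<O> \<and> complex_dim X \<O> = 1"

end

theory Submission
  imports Defs "HOL-Complex_Analysis.Complex_Analysis"
begin

text \<open>
  The space is the complex plane with its usual topology, but with a structure sheaf that puts a cusp
  at every integer \<open>n \<ge> 1\<close>: near \<open>n\<close>, with \<open>t = z - n\<close>, a function is holomorphic if it is a
  holomorphic function of \<open>x = t\<^sup>n\<^sup>+\<^sup>1\<close> and \<open>y = t\<^sup>n\<^sup>+\<^sup>2\<close>. The germ of the space at \<open>n\<close> is thus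
  that of the curve \<open>y\<^sup>n\<^sup>+\<^sup>1 = x\<^sup>n\<^sup>+\<^sup>2\<close>, which \<open>t\<close> parametrises, with \<open>t = y/x\<close> away from the cusp.
  A section that vanishes at \<open>n\<close> vanishes there to order at least \<open>n + 1\<close>
  (\<open>cusp_germ_vanishing_order\<close>). The function \<open>f(z) = sin (\<pi>z)\<close> is holomorphic wherever the space is
  smooth and vanishes at all cusps, so it is holomorphic off its zero set; but \<open>f\<^sup>n\<close> has a zero of order
  exactly \<open>n\<close> at the cusp \<open>n\<close> and hence is not a section there. The cusps have to get worse without
  bound, because for each single cusp every sufficiently high power of \<open>f\<close> is a section near it.

  That this space is an irreducible curve is elementary: its sections are holomorphic in the usual
  sense, so the identity theorem gives irreducibility, and \<open>x\<close> alone cuts out a point. To show that it is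
  Stein one needs many global sections. A function that equals a constant up to a multiple of \<open>t ^ (p * p)\<close>
  with \<open>p = n + 1\<close> is a section at the cusp \<open>n\<close> (\<open>cusp_germ_if_high_order\<close>). The Weierstrass product
  theorem yields an entire \<open>H\<close> that has zeros of order at least \<open>p\<^sup>2\<close> at the cusps and no others, and that is
  non-negative on the real axis (\<open>cusp_weight_exists\<close>). Then \<open>H q\<close> and all primitives of \<open>H q\<close> are
  global sections for every entire \<open>q\<close>. The products \<open>H q\<close> separate points and dominate bounds
  away from the cusps. At the cusps, where \<open>H q\<close> vanishes, primitives do the same work: they are real
  integrals of functions without sign changes, so positive contributions do not cancel
  (\<open>primitive_increment\<close>).
\<close>

section \<open>Holomorphic functions of two variables\<close>

text \<open>
  Complex differentiability at a point of \<open>\<complex>\<^sup>2\<close>, formulated on the product type because that is a normed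
  space and the chain rule for \<^const>\<open>has_derivative\<close> applies to it.
\<close>

definition cdiff2_at :: "(complex \<times> complex \<Rightarrow> complex) \<Rightarrow> complex \<times> complex \<Rightarrow> bool" where
  "cdiff2_at G v \<longleftrightarrow> (\<exists>a b. (G has_derivative (\<lambda>d. a * fst d + b * snd d)) (at v))"

lemma cdiff2_at_const [simp]: "cdiff2_at (\<lambda>v. c) v"
  unfolding cdiff2_at_def by (rule exI[of _ 0], rule exI[of _ 0]) simp

lemma cdiff2_at_fst [simp]: "cdiff2_at fst v"
  unfolding cdiff2_at_def
  by (rule exI[of _ 1], rule exI[of _ 0]) (auto intro!: derivative_eq_intros)

lemma cdiff2_at_snd [simp]: "cdiff2_at snd v"
  unfolding cdiff2_at_def
  by (rule exI[of _ 0], rule exI[of _ 1]) (auto intro!: derivative_eq_intros)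

lemma cdiff2_at_add:
  assumes "cdiff2_at F v" "cdiff2_at G v"
  shows "cdiff2_at (\<lambda>v. F v + G v) v"
proof -
  obtain a b a' b' where
    "(F has_derivative (\<lambda>d. a * fst d + b * snd d)) (at v)"
    "(G has_derivative (\<lambda>d. a' * fst d + b' * snd d)) (at v)"
    using assms unfolding cdiff2_at_def by blast
  then have "((\<lambda>v. F v + G v) has_derivative (\<lambda>d. (a + a') * fst d + (b + b') * snd d)) (at v)"
    by (auto intro!: derivative_eq_intros simp: algebra_simps)
  then show ?thesis unfolding cdiff2_at_def by blast
qed

lemma cdiff2_at_mult:
  assumes "cdiff2_at F v" "cdiff2_at G v"
  shows "cdiff2_at (\<lambda>v. F v * G v) v"
proof -
  obtain a b a' b' where
    "(F has_derivative (\<lambda>d. a * fst d + b * snd d)) (at v)"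
    "(G has_derivative (\<lambda>d. a' * fst d + b' * snd d)) (at v)"
    using assms unfolding cdiff2_at_def by blast
  then have "((\<lambda>v. F v * G v) has_derivative
      (\<lambda>d. (F v * a' + a * G v) * fst d + (F v * b' + b * G v) * snd d)) (at v)"
    by (auto intro!: derivative_eq_intros simp: algebra_simps)
  then show ?thesis unfolding cdiff2_at_def by blast
qed

lemma cdiff2_at_compose:
  assumes "cdiff2_at G v" "g field_differentiable at (G v)"
  shows "cdiff2_at (\<lambda>v. g (G v)) v"
proof -
  obtain a b where G: "(G has_derivative (\<lambda>d. a * fst d + b * snd d)) (at v)"
    using assms unfolding cdiff2_at_def by blast
  obtain c where "(g has_field_derivative c) (at (G v))"
    using assms by (auto simp: field_differentiable_def)
  then have "(g has_derivative (*) c) (at (G v))"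
    by (simp add: has_field_derivative_def)
  from has_derivative_compose[OF G this]
  have "((\<lambda>v. g (G v)) has_derivative (\<lambda>d. (c * a) * fst d + (c * b) * snd d)) (at v)"
    by (simp only: distrib_left mult.assoc)
  then show ?thesis unfolding cdiff2_at_def by blast
qed

lemma cdiff2_at_power: "cdiff2_at F v \<Longrightarrow> cdiff2_at (\<lambda>v. F v ^ n) v"
  by (induction n) (simp_all add: cdiff2_at_mult)

lemma cdiff2_at_diff:
  "cdiff2_at F v \<Longrightarrow> cdiff2_at G v \<Longrightarrow> cdiff2_at (\<lambda>v. F v - G v) v"
  using cdiff2_at_add[of F v, OF _ cdiff2_at_mult[OF cdiff2_at_const[of "-1" v], of G]] by simp

lemma cdiff2_at_divide:
  assumes "cdiff2_at F v" "cdiff2_at G v" "G v \<noteq> 0"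
  shows "cdiff2_at (\<lambda>v. F v / G v) v"
proof -
  have "cdiff2_at (\<lambda>v. inverse (G v)) v"
    by (rule cdiff2_at_compose[where g = inverse, OF assms(2)
          field_differentiable_inverse[OF field_differentiable_ident assms(3)]])
  from cdiff2_at_mult[OF assms(1) this] show ?thesis
    by (simp add: divide_inverse)
qed

lemma cdiff2_at_sum:
  "(\<And>i. i \<in> I \<Longrightarrow> cdiff2_at (F i) v) \<Longrightarrow> cdiff2_at (\<lambda>v. \<Sum>i\<in>I. F i v) v"
  by (induction I rule: infinite_finite_induct) (simp_all add: cdiff2_at_add)

lemma field_differentiable_curve:
  assumes "cdiff2_at G (c w, d w)" "c field_differentiable at w" "d field_differentiable at w"
  shows "(\<lambda>w. G (c w, d w)) field_differentiable at w"
proof -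
  obtain a b where G: "(G has_derivative (\<lambda>d. a * fst d + b * snd d)) (at (c w, d w))"
    using assms unfolding cdiff2_at_def by blast
  obtain c' d' where "(c has_field_derivative c') (at w)" "(d has_field_derivative d') (at w)"
    using assms by (auto simp: field_differentiable_def)
  then have "((\<lambda>w. (c w, d w)) has_derivative (\<lambda>h. (c' * h, d' * h))) (at w)"
    by (auto simp: has_field_derivative_def intro!: derivative_eq_intros)
  from has_derivative_compose[OF this G]
  moreover have "(\<lambda>h. a * fst (c' * h, d' * h) + b * snd (c' * h, d' * h))
      = (*) (a * c' + b * d')"
    by (simp add: fun_eq_iff algebra_simps)
  ultimately have "((\<lambda>w. G (c w, d w)) has_derivative (*) (a * c' + b * d')) (at w)"
    by (simp only:)
  then show ?thesis
    unfolding field_differentiable_def has_field_derivative_def by blast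
qed


section \<open>The plane as a two-dimensional local model\<close>

definition emb2 :: "complex \<times> complex \<Rightarrow> nat \<Rightarrow> complex" where
  "emb2 v = (\<lambda>i. if i = 0 then fst v else if i = 1 then snd v else 0)"

definition coord2 :: "(nat \<Rightarrow> complex) \<Rightarrow> complex \<times> complex" where
  "coord2 w = (w 0, w 1)"

lemma emb2_0 [simp]: "emb2 v 0 = fst v" and emb2_1 [simp]: "emb2 v (Suc 0) = snd v"
  by (simp_all add: emb2_def)

lemma coord2_emb2 [simp]: "coord2 (emb2 v) = v"
  by (simp add: emb2_def coord2_def)

lemma emb2_eq_iff [simp]: "emb2 v = emb2 w \<longleftrightarrow> v = w"
  by (metis coord2_emb2)

lemma continuous_on_emb2: "continuous_on S emb2"
proof (rule continuous_on_coordinatewise_then_product)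
  show "continuous_on S (\<lambda>v. emb2 v i)" for i
    by (cases "i = 0"; cases "i = 1") (simp_all add: emb2_def continuous_on_fst continuous_on_snd)
qed

lemma continuous_on_coord2: "continuous_on S coord2"
  unfolding coord2_def
  by (intro continuous_on_Pair continuous_on_subset[OF continuous_on_product_coordinates subset_UNIV])

lemma range_emb2: "range emb2 = {z. \<forall>i\<ge>2. z i = 0}"
proof -
  have "w = emb2 (w 0, w 1)" if w: "\<forall>i\<ge>2. w i = 0" for w
  proof
    show "w i = emb2 (w 0, w 1) i" for i
      using w by (cases "i \<ge> 2") (auto simp: emb2_def less_2_cases_iff not_le)
  qed
  then show ?thesis by (auto simp: emb2_def)
qed

lemma Complex_space_2: "Complex_space 2 = top_of_set (range emb2)"
  unfolding Complex_space_def range_emb2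
  by (simp add: euclidean_product_topology)

lemma openin_Complex_space_2: "openin (Complex_space 2) N \<longleftrightarrow> (\<exists>S. open S \<and> N = emb2 ` S)"
proof
  assume "openin (Complex_space 2) N"
  then obtain T where T: "open T" "N = range emb2 \<inter> T"
    unfolding Complex_space_2 by (auto simp: openin_open)
  have "open (emb2 -` T)"
    using T continuous_on_emb2[of UNIV] by (simp add: open_vimage)
  moreover have "N = emb2 ` (emb2 -` T)" using T by auto
  ultimately show "\<exists>S. open S \<and> N = emb2 ` S" by blast
next
  assume "\<exists>S. open S \<and> N = emb2 ` S"
  then obtain S where S: "open S" "N = emb2 ` S" by blast
  have "open (coord2 -` S)"
    using S continuous_on_coord2[of UNIV] by (simp add: open_vimage)
  moreover have "N = range emb2 \<inter> coord2 -` S" using S by force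
  ultimately show "openin (Complex_space 2) N"
    unfolding Complex_space_2 openin_open by blast
qed

text \<open>
  The map \<^const>\<open>emb2\<close> is a homeomorphism onto its image and carries the norm of the product to the
  distance in the denominator of \<^const>\<open>holo\<close>, so the two difference quotients are the same.
\<close>

lemma holo_2_iff:
  assumes "open S"
  shows "F \<in> holo 2 (emb2 ` S) \<longleftrightarrow> (\<forall>v\<in>S. cdiff2_at (\<lambda>v. F (emb2 v)) v)"
proof -
  have norm: "L2_set (\<lambda>i. cmod (emb2 w i - emb2 v i)) {..<2} = norm (w - v)" for v w
    by (simp add: L2_set_def numeral_2_eq_2 norm_prod_def)
  have key: "((\<lambda>w. (F w - F (emb2 v) - (\<Sum>i<2. a i * (w i - emb2 v i)))
            / complex_of_real (L2_set (\<lambda>i. cmod (w i - emb2 v i)) {..<2})) \<longlongrightarrow> 0)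
            (at (emb2 v) within emb2 ` S) \<longleftrightarrow>
     ((\<lambda>v. F (emb2 v)) has_derivative (\<lambda>d. a 0 * fst d + a 1 * snd d)) (at v)" (is "?L \<longleftrightarrow> ?R")
    if v: "v \<in> S" for a v
  proof -
    let ?q = "\<lambda>w. (F w - F (emb2 v) - (\<Sum>i<2. a i * (w i - emb2 v i)))
            / complex_of_real (L2_set (\<lambda>i. cmod (w i - emb2 v i)) {..<2})"
    have 1: "filterlim emb2 (at (emb2 v) within emb2 ` S) (at v within S)"
      using continuous_on_emb2[of S] v
      by (simp add: filterlim_at eventually_at_filter continuous_on_def)
    have 2: "filterlim coord2 (at v within S) (at (emb2 v) within emb2 ` S)"
    proof -
      have "(coord2 \<longlongrightarrow> v) (at (emb2 v) within emb2 ` S)"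
        using continuous_on_coord2[of "emb2 ` S"] v by (auto simp: continuous_on_def)
      then show ?thesis
        by (auto simp: filterlim_at eventually_at_filter intro!: always_eventually)
    qed
    have bl: "bounded_linear (\<lambda>d. a 0 * fst d + a 1 * snd d)"
      by (intro bounded_linear_add bounded_linear_mult_right bounded_linear_const_mult
          bounded_linear_fst bounded_linear_snd)
    have q: "?q (emb2 u) = ((F (emb2 u) - F (emb2 v))
          - (a 0 * fst (u - v) + a 1 * snd (u - v))) /\<^sub>R norm (u - v)" for u
      unfolding norm by (simp add: numeral_2_eq_2 scaleR_conv_of_real divide_inverse)
    have "?L \<longleftrightarrow> ((\<lambda>v. ?q (emb2 v)) \<longlongrightarrow> 0) (at v within S)"
    proof
      assume ?L from filterlim_compose[OF this 1]
      show "((\<lambda>v. ?q (emb2 v)) \<longlongrightarrow> 0) (at v within S)" .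
    next
      assume "((\<lambda>v. ?q (emb2 v)) \<longlongrightarrow> 0) (at v within S)"
      from filterlim_compose[OF this 2]
      have "((\<lambda>w. ?q (emb2 (coord2 w))) \<longlongrightarrow> 0) (at (emb2 v) within emb2 ` S)" .
      then show ?L
        by (rule Lim_transform_eventually) (auto simp: eventually_at_filter intro!: always_eventually)
    qed
    also have "\<dots> \<longleftrightarrow> ((\<lambda>v. F (emb2 v)) has_derivative (\<lambda>d. a 0 * fst d + a 1 * snd d)) (at v within S)"
      by (simp only: has_derivative_at_within q bl simp_thms)
    also have "\<dots> \<longleftrightarrow> ?R"
      using at_within_open[OF v assms] by (simp only:)
    finally show ?thesis .
  qed
  have "(\<forall>z\<in>emb2 ` S. Q z) \<longleftrightarrow> (\<forall>v\<in>S. Q (emb2 v))" for Q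
    by blast
  then have "F \<in> holo 2 (emb2 ` S) \<longleftrightarrow> (\<forall>v\<in>S. \<exists>a. ((\<lambda>v. F (emb2 v)) has_derivative
     (\<lambda>d. a (0::nat) * fst d + a 1 * snd d)) (at v))"
    by (simp only: holo_def mem_Collect_eq key cong: ball_cong)
  also have "\<dots> \<longleftrightarrow> (\<forall>v\<in>S. cdiff2_at (\<lambda>v. F (emb2 v)) v)"
  proof -
    have "\<exists>a. P (a (0::nat)) (a 1)" if "P c d" for P :: "complex \<Rightarrow> complex \<Rightarrow> bool" and c d
      using that by (intro exI[of _ "\<lambda>i. if i = 0 then c else d"]) simp
    then show ?thesis unfolding cdiff2_at_def by meson
  qed
  finally show ?thesis .
qed


section \<open>Germs on a cusp\<close>

definition cusp_map :: "nat \<Rightarrow> complex \<Rightarrow> complex \<Rightarrow> complex \<times> complex" where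
  "cusp_map p z w = ((w - z) ^ p, (w - z) ^ Suc p)"

text \<open>
  The ring of germs \<open>\<complex>{t\<^sup>p, t\<^sup>p\<^sup>+\<^sup>1}\<close> in the local parameter \<open>t = w - z\<close>.
\<close>

definition cusp_germ :: "nat \<Rightarrow> complex \<Rightarrow> (complex \<Rightarrow> complex) \<Rightarrow> bool" where
  "cusp_germ p z g \<longleftrightarrow> (\<exists>S G. open S \<and> (0, 0) \<in> S \<and> (\<forall>v\<in>S. cdiff2_at G v) \<and>
     (\<forall>\<^sub>F w in nhds z. g w = G (cusp_map p z w)))"

lemma cusp_map_base: "0 < p \<Longrightarrow> cusp_map p z z = (0, 0)"
  by (simp add: cusp_map_def)

lemma continuous_on_cusp_map: "continuous_on S (cusp_map p z)"
  unfolding cusp_map_def by (intro continuous_intros)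

lemma open_cusp_map_vimage: "open S \<Longrightarrow> open (cusp_map p z -` S)"
  using continuous_on_cusp_map[of UNIV p z] by (simp add: open_vimage)

lemma field_differentiable_cusp_map:
  "cdiff2_at G (cusp_map p z w) \<Longrightarrow> (\<lambda>w. G (cusp_map p z w)) field_differentiable at w"
  unfolding cusp_map_def
  by (erule field_differentiable_curve) (intro derivative_intros)+

lemma cusp_germ_cong:
  assumes "\<forall>\<^sub>F w in nhds z. f w = g w" "cusp_germ p z f"
  shows "cusp_germ p z g"
proof -
  obtain S G where *: "open S" "(0, 0) \<in> S" "\<forall>v\<in>S. cdiff2_at G v"
    "\<forall>\<^sub>F w in nhds z. f w = G (cusp_map p z w)"
    using assms(2) unfolding cusp_germ_def by blast
  have "\<forall>\<^sub>F w in nhds z. g w = G (cusp_map p z w)"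
    using assms(1) *(4) by eventually_elim simp
  with * show ?thesis unfolding cusp_germ_def by blast
qed

text \<open>
  For \<open>p = 1\<close> the curve is the parabola \<open>y = x\<^sup>2\<close>, with coordinate \<open>x = t\<close>. Smooth points are thus
  covered by the same local model as cusps.
\<close>

lemma cusp_germ_1I:
  assumes "g analytic_on {z}"
  shows "cusp_germ 1 z g"
proof -
  obtain T where T: "open T" "z \<in> T" "g holomorphic_on T"
    using assms by (auto simp: analytic_at)
  let ?S = "(\<lambda>v. z + fst v) -` T"
  have "open ?S"
    using T by (intro open_vimage continuous_intros)
  moreover have "(0, 0) \<in> ?S" using T by simp
  moreover have "cdiff2_at (\<lambda>v. g (z + fst v)) v" if "v \<in> ?S" for v
  proof (rule cdiff2_at_compose[where g = g])
    show "cdiff2_at (\<lambda>v. z + fst v) v"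
      by (rule cdiff2_at_add) simp_all
    show "g field_differentiable at (z + fst v)"
      using T that holomorphic_on_imp_differentiable_at by auto
  qed
  moreover have "\<forall>\<^sub>F w in nhds z. g w = g (z + fst (cusp_map 1 z w))"
    by (simp add: cusp_map_def)
  ultimately show ?thesis unfolding cusp_germ_def by blast
qed

lemma cusp_germ_imp_analytic:
  assumes "cusp_germ p z g" "0 < p"
  shows "g analytic_on {z}"
proof -
  obtain S G where *: "open S" "(0, 0) \<in> S" "\<forall>v\<in>S. cdiff2_at G v"
    "\<forall>\<^sub>F w in nhds z. g w = G (cusp_map p z w)"
    using assms unfolding cusp_germ_def by blast
  let ?T = "cusp_map p z -` S"
  have "open ?T" "z \<in> ?T"
    using * assms(2) by (auto simp: open_cusp_map_vimage cusp_map_base)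
  moreover have "(\<lambda>w. G (cusp_map p z w)) holomorphic_on ?T"
    using * \<open>open ?T\<close> field_differentiable_cusp_map[of G p z]
    by (auto simp: holomorphic_on_def intro: field_differentiable_at_within)
  ultimately have "(\<lambda>w. G (cusp_map p z w)) analytic_on {z}"
    by (auto simp: analytic_at)
  moreover have "g analytic_on {z} \<longleftrightarrow> (\<lambda>w. G (cusp_map p z w)) analytic_on {z}"
    by (rule analytic_at_cong[OF *(4) refl])
  ultimately show ?thesis by simp
qed

text \<open>
  A function that is differentiable and zero at the origin of \<open>\<complex>\<^sup>2\<close> is bounded there by a multiple of
  the norm, and the norm of \<open>(t\<^sup>p, t\<^sup>p\<^sup>+\<^sup>1)\<close> has order \<open>|t|\<^sup>p\<close>.
\<close>

lemma cusp_germ_vanishing_order: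
  assumes "cusp_germ (Suc n) z g" "g z = 0"
  shows "((\<lambda>w. g w / (w - z) ^ n) \<longlongrightarrow> 0) (at z)"
proof -
  let ?\<phi> = "cusp_map (Suc n) z"
  obtain S G where *: "open S" "(0, 0) \<in> S" "\<forall>v\<in>S. cdiff2_at G v"
    "\<forall>\<^sub>F w in nhds z. g w = G (?\<phi> w)"
    using assms unfolding cusp_germ_def by blast
  have G0: "G (0, 0) = 0"
    using eventually_nhds_x_imp_x[OF *(4)] assms(2) cusp_map_base[of "Suc n" z] by simp
  obtain G' where G': "(G has_derivative G') (at (0, 0))"
    using *(2,3) unfolding cdiff2_at_def by blast
  then obtain d where d: "d > 0"
    "\<And>v. norm (v - (0, 0)) < d \<Longrightarrow> norm (G v - G (0, 0) - G' (v - (0, 0))) \<le> 1 * norm (v - (0, 0))"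
    unfolding has_derivative_at_alt by (meson zero_less_one)
  obtain K where K: "\<And>v. norm (G' v) \<le> norm v * K"
    using bounded_linear.bounded[OF has_derivative_bounded_linear[OF G']] by blast
  have bound: "norm (G v) \<le> (1 + K) * norm v" if "norm v < d" for v
  proof -
    have z: "v - (0, 0) = v" by (simp add: prod_eq_iff)
    have "norm (G v - G' v) \<le> norm v"
      using d(2)[of v] that unfolding z G0 by simp
    then show ?thesis
      using K[of v] norm_triangle_ineq2[of "G v" "G' v"] by (simp add: algebra_simps)
  qed
  have ev: "\<forall>\<^sub>F w in at z. norm (g w / (w - z) ^ n) \<le> (1 + K) * norm (w - z, (w - z)\<^sup>2)"
  proof -
    have "(?\<phi> \<longlongrightarrow> ?\<phi> z) (at z)"
      using continuous_on_cusp_map[of UNIV "Suc n" z] by (simp add: continuous_on_def)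
    then have "(?\<phi> \<longlongrightarrow> (0, 0)) (at z)"
      by (simp only: cusp_map_base[OF zero_less_Suc])
    then have "\<forall>\<^sub>F w in at z. norm (?\<phi> w) < d"
      using d(1) tendsto_norm[of ?\<phi> "(0, 0)" "at z"]
      by (intro order_tendstoD(2)[of "\<lambda>w. norm (?\<phi> w)" 0]) (simp_all add: zero_prod_def[symmetric])
    moreover have "\<forall>\<^sub>F w in at z. g w = G (?\<phi> w)"
      using *(4) by (simp add: eventually_at_filter eventually_mono)
    moreover have "\<forall>\<^sub>F w in at z. w \<noteq> z"
      by (simp add: eventually_at_filter)
    ultimately show ?thesis
    proof eventually_elim
      case (elim w)
      let ?t = "w - z"
      have "norm (a * x, a * y) = norm a * norm (x, y)" for a x y :: complex
        by (simp add: norm_prod_def norm_mult power_mult_distrib real_sqrt_mult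
            flip: distrib_left)
      from this[of "?t ^ n" ?t "?t\<^sup>2"]
      have "norm (?\<phi> w) = norm (?t ^ n) * norm (?t, ?t\<^sup>2)"
        by (simp add: cusp_map_def power2_eq_square mult_ac)
      then have "norm (g w) \<le> (1 + K) * (norm (?t ^ n) * norm (?t, ?t\<^sup>2))"
        using bound[OF elim(1)] elim(2) by simp
      then show ?case
        using elim(3) by (simp add: norm_divide divide_le_eq mult_ac)
    qed
  qed
  have "((\<lambda>w. (1 + K) * norm (w - z, (w - z)\<^sup>2)) \<longlongrightarrow> (1 + K) * norm (z - z, (z - z)\<^sup>2)) (at z)"
    by (intro tendsto_intros)
  then have "((\<lambda>w. (1 + K) * norm (w - z, (w - z)\<^sup>2)) \<longlongrightarrow> 0) (at z)"
    by (simp add: zero_prod_def[symmetric])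
  from Lim_null_comparison[OF ev this] show ?thesis .
qed

text \<open>
  Every monomial in \<open>t\<close> of degree at least \<open>p\<^sup>2\<close> is a monomial in \<open>x = t\<^sup>p\<close> and \<open>y = t\<^sup>p\<^sup>+\<^sup>1\<close>. For a whole
  power series \<open>t ^ (p * p) u(t)\<close> this is done at once by sorting the exponents of \<open>u\<close> by residue modulo
  \<open>p\<close>: if \<open>u(t)\<close> is the sum of the \<open>t\<^sup>j u\<^sub>j(t\<^sup>p)\<close> over \<open>j < p\<close>, then \<open>t ^ (p * p + j) = x\<^sup>p\<^sup>-\<^sup>j y\<^sup>j\<close>.
\<close>

lemma holomorphic_residue_decomposition:
  assumes u: "u holomorphic_on ball z r" and "0 < p" "0 < r"
  obtains U where "\<And>j. j < p \<Longrightarrow> U j holomorphic_on ball 0 (r ^ p)"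
    "\<And>w. w \<in> ball z r \<Longrightarrow> u w = (\<Sum>j<p. (w - z) ^ j * U j ((w - z) ^ p))"
proof -
  define b where "b = (\<lambda>n. (deriv ^^ n) u z / fact n)"
  have sums: "(\<lambda>n. b n * (w - z) ^ n) sums u w" if "w \<in> ball z r" for w
    using holomorphic_power_series[OF u that] by (simp add: b_def)
  have abs_sums: "summable (\<lambda>n. norm (b n * t ^ n))" if t: "norm t < r" for t
  proof -
    \<comment> \<open>Absolute convergence at \<open>t\<close> comes from convergence at a point of larger modulus.\<close>
    obtain s where s: "norm t < s" "s < r" using dense[OF t] by blast
    then have "0 \<le> s" using norm_ge_zero[of t] by linarith
    have "z + of_real s \<in> ball z r" using s \<open>0 \<le> s\<close> by (simp add: dist_norm)
    from sums_summable[OF sums[OF this]] have "summable (\<lambda>n. b n * of_real s ^ n)" by simp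
    then show ?thesis
      by (rule powser_insidea) (use s \<open>0 \<le> s\<close> in simp)
  qed
  have pw: "t ^ (n * p + j) = (t ^ p) ^ n * t ^ j" for t :: complex and n j
    by (simp only: power_add power_mult mult.commute[of n p])
  define U where "U = (\<lambda>j s. \<Sum>n. b (n * p + j) * s ^ n)"
  have U: "(\<lambda>n. b (n * p + j) * (t ^ p) ^ n) sums U j (t ^ p)" if t: "norm t < r" for j t
  proof -
    have "summable (\<lambda>n. b (n * p + j) * (t ^ p) ^ n)"
    proof (cases "t = 0")
      case True
      then show ?thesis using \<open>0 < p\<close>
        by (intro summable_finite[of "{0}"]) (auto simp: power_0_left)
    next
      case False
      have "summable ((\<lambda>n. norm (b n * t ^ n)) \<circ> (\<lambda>n. n * p + j))"
        using \<open>0 < p\<close> by (intro summable_reindex[OF abs_sums[OF t]]) (auto simp: inj_def)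
      then have "summable (\<lambda>n. norm (b (n * p + j) * t ^ (n * p + j)))"
        by (simp add: o_def)
      then have "summable (\<lambda>n. b (n * p + j) * t ^ (n * p + j))"
        by (rule summable_norm_cancel)
      then have "summable (\<lambda>n. b (n * p + j) * t ^ (n * p + j) / t ^ j)"
        by (rule summable_divide)
      then show ?thesis
        using False by (simp add: pw)
    qed
    then show ?thesis unfolding U_def by (rule summable_sums)
  qed
  show ?thesis
  proof (rule that[of U])
    fix j assume "j < p"
    show "U j holomorphic_on ball 0 (r ^ p)"
    proof (rule power_series_holomorphic[where a = "\<lambda>n. b (n * p + j)"])
      fix s :: complex assume "s \<in> ball 0 (r ^ p)"
      then have s: "norm s < r ^ p" by simp
      \<comment> \<open>Any \<open>p\<close>-th root of \<open>s\<close> lies in the disc of radius \<open>r\<close>.\<close>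
      obtain t where t: "t ^ p = s"
        using exists_complex_root[of p s] \<open>0 < p\<close> by (metis less_numeral_extra(3))
      have "norm t < r"
        using s t \<open>0 < r\<close> power_less_imp_less_base[of "norm t" p r]
        by (simp add: norm_power[symmetric])
      from U[OF this, of j]
      show "(\<lambda>n. b (n * p + j) * (s - 0) ^ n) sums U j s"
        by (simp add: t)
    qed
  next
    fix w assume w: "w \<in> ball z r"
    define t where "t = w - z"
    have "norm t < r" using w by (simp add: t_def dist_norm norm_minus_commute)
    then have "(\<lambda>n. \<Sum>j<p. t ^ j * (b (n * p + j) * (t ^ p) ^ n)) sums (\<Sum>j<p. t ^ j * U j (t ^ p))"
      by (intro sums_sum sums_mult U)
    also have "(\<lambda>n. \<Sum>j<p. t ^ j * (b (n * p + j) * (t ^ p) ^ n))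
        = (\<lambda>n. \<Sum>i\<in>{n * p..<n * p + p}. b i * t ^ i)"
    proof
      fix n
      have "(\<Sum>i\<in>{n * p..<n * p + p}. b i * t ^ i) = (\<Sum>j\<in>{0..<p}. b (n * p + j) * t ^ (n * p + j))"
        using sum.shift_bounds_nat_ivl[of "\<lambda>i. b i * t ^ i" 0 "n * p" p] by (simp add: add.commute)
      then show "(\<Sum>j<p. t ^ j * (b (n * p + j) * (t ^ p) ^ n)) = (\<Sum>i\<in>{n * p..<n * p + p}. b i * t ^ i)"
        by (simp add: pw atLeast0LessThan mult_ac)
    qed
    finally have "(\<lambda>n. \<Sum>i\<in>{n * p..<n * p + p}. b i * t ^ i) sums (\<Sum>j<p. t ^ j * U j (t ^ p))" .
    moreover have "(\<lambda>n. \<Sum>i\<in>{n * p..<n * p + p}. b i * t ^ i) sums u w"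
      using sums_group[OF sums[OF w] \<open>0 < p\<close>] by (simp add: t_def)
    ultimately show "u w = (\<Sum>j<p. (w - z) ^ j * U j ((w - z) ^ p))"
      unfolding t_def by (rule sums_unique2[symmetric])
  qed
qed

lemma cusp_germ_if_high_order:
  assumes "u holomorphic_on ball z r" "0 < p" "0 < r"
    and g: "\<And>w. w \<in> ball z r \<Longrightarrow> g w = c + (w - z) ^ (p * p) * u w"
  shows "cusp_germ p z g"
proof (rule holomorphic_residue_decomposition[OF assms(1-3)])
  fix U
  assume U: "\<And>j. j < p \<Longrightarrow> U j holomorphic_on ball 0 (r ^ p)"
    "\<And>w. w \<in> ball z r \<Longrightarrow> u w = (\<Sum>j<p. (w - z) ^ j * U j ((w - z) ^ p))"
  define S :: "(complex \<times> complex) set" where "S = fst -` ball (0::complex) (r ^ p)"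
  define G where "G = (\<lambda>v. c + (\<Sum>j<p. fst v ^ (p - j) * snd v ^ j * U j (fst v)))"
  have "open S"
    unfolding S_def by (intro open_vimage continuous_intros) simp
  moreover have "(0, 0) \<in> S" using assms by (simp add: S_def)
  moreover have "\<forall>v\<in>S. cdiff2_at G v"
  proof
    fix v assume v: "v \<in> S"
    have "cdiff2_at (\<lambda>v. fst v ^ (p - j) * snd v ^ j * U j (fst v)) v" if "j \<in> {..<p}" for j
    proof -
      have "U j field_differentiable at (fst v)"
        using that v by (intro holomorphic_on_imp_differentiable_at[OF U(1)]) (auto simp: S_def)
      then have "cdiff2_at (\<lambda>v. U j (fst v)) v"
        by (rule cdiff2_at_compose[where g = "U j", OF cdiff2_at_fst])
      then show ?thesis
        by (rule cdiff2_at_mult[OF cdiff2_at_mult[OF cdiff2_at_power[OF cdiff2_at_fst]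
              cdiff2_at_power[OF cdiff2_at_snd]]])
    qed
    then have "cdiff2_at (\<lambda>v. \<Sum>j<p. fst v ^ (p - j) * snd v ^ j * U j (fst v)) v"
      by (rule cdiff2_at_sum)
    then show "cdiff2_at G v"
      unfolding G_def by (rule cdiff2_at_add[OF cdiff2_at_const])
  qed
  moreover have "g w = G (cusp_map p z w)" if "w \<in> ball z r" for w
  proof -
    have monomial: "(w - z) ^ (p * p) * (w - z) ^ j = ((w - z) ^ p) ^ (p - j) * ((w - z) ^ Suc p) ^ j"
      if j: "j < p" for j
    proof -
      obtain k where k: "p = j + k" using less_imp_add_positive[OF j] by auto
      have "p * p + j = p * (p - j) + Suc p * j"
        unfolding k by (simp add: algebra_simps)
      then have "(w - z) ^ (p * p + j) = (w - z) ^ (p * (p - j) + Suc p * j)"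
        by (rule arg_cong)
      then show ?thesis
        by (simp only: power_add power_mult)
    qed
    have "g w = c + (\<Sum>j<p. ((w - z) ^ (p * p) * (w - z) ^ j) * U j ((w - z) ^ p))"
      using g[OF that] U(2)[OF that] by (simp only: sum_distrib_left mult.assoc)
    also have "\<dots> = G (cusp_map p z w)"
      unfolding G_def cusp_map_def fst_conv snd_conv
      by (intro arg_cong[of _ _ "(+) c"] sum.cong refl) (simp only: monomial lessThan_iff)
    finally show ?thesis .
  qed
  then have "\<forall>\<^sub>F w in nhds z. g w = G (cusp_map p z w)"
    using eventually_nhds_in_open[of "ball z r" z] \<open>0 < r\<close> by (auto elim: eventually_mono)
  ultimately show ?thesis unfolding cusp_germ_def by blast
qed


section \<open>The parametrised cusp as a local model\<close>

lemma model_sections_2_iff: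
  "h \<in> model_sections 2 (emb2 ` V) \<longleftrightarrow> (\<forall>v\<in>V. \<exists>S G. open S \<and> v \<in> S \<and>
     (\<forall>s\<in>S. cdiff2_at G s) \<and> (\<forall>q\<in>S \<inter> V. h (emb2 q) = G q))"
  (is "_ \<longleftrightarrow> (\<forall>v\<in>V. ?P v)")
proof -
  have "(\<exists>N F. openin (Complex_space 2) N \<and> emb2 v \<in> N \<and> F \<in> holo 2 N \<and>
      (\<forall>q\<in>N \<inter> emb2 ` V. h q = F q)) \<longleftrightarrow> ?P v" (is "?L \<longleftrightarrow> _") for v
  proof
    assume ?L
    then obtain N F where NF: "openin (Complex_space 2) N" "emb2 v \<in> N" "F \<in> holo 2 N"
      "\<forall>q\<in>N \<inter> emb2 ` V. h q = F q" by blast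
    obtain S where S: "open S" "N = emb2 ` S"
      using NF(1) unfolding openin_Complex_space_2 by blast
    have "v \<in> S" using NF(2) unfolding S(2) by auto
    moreover have "\<forall>s\<in>S. cdiff2_at (\<lambda>s. F (emb2 s)) s"
      using NF(3) unfolding S(2) holo_2_iff[OF S(1)] .
    moreover have "\<forall>q\<in>S \<inter> V. h (emb2 q) = F (emb2 q)"
      using NF(4) unfolding S(2) by blast
    ultimately show "?P v" using S(1) by blast
  next
    assume "?P v"
    then obtain S G where S: "open S" "v \<in> S" "\<forall>s\<in>S. cdiff2_at G s"
      "\<forall>q\<in>S \<inter> V. h (emb2 q) = G q" by blast
    have "openin (Complex_space 2) (emb2 ` S)"
      unfolding openin_Complex_space_2 using S(1) by blast
    moreover have "(\<lambda>w. G (coord2 w)) \<in> holo 2 (emb2 ` S)"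
      using S(3) by (simp add: holo_2_iff[OF S(1)])
    moreover have "\<forall>q\<in>emb2 ` S \<inter> emb2 ` V. h q = G (coord2 q)"
      using S(4) by auto
    ultimately show ?L using S(2) by blast
  qed
  then show ?thesis
    unfolding model_sections_def by simp
qed

definition cusp_disc :: "nat \<Rightarrow> real \<Rightarrow> (complex \<times> complex) set" where
  "cusp_disc p r = {v. norm (fst v) < r ^ p}"

lemma open_cusp_disc: "open (cusp_disc p r)"
  unfolding cusp_disc_def by (intro open_Collect_less continuous_intros)

definition cusp_curve :: "nat \<Rightarrow> real \<Rightarrow> (complex \<times> complex) set" where
  "cusp_curve p r = {v \<in> cusp_disc p r. snd v ^ p = fst v ^ Suc p}"

text \<open>
  The inverse \<open>t = y/x\<close> of the parametrisation. As \<open>0/0 = 0\<close>, it sends the singular point to \<open>z\<close>,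
  as it should.
\<close>

definition cusp_param :: "complex \<Rightarrow> complex \<times> complex \<Rightarrow> complex" where
  "cusp_param z v = z + snd v / fst v"

lemma cusp_param_cusp_map: "0 < p \<Longrightarrow> cusp_param z (cusp_map p z w) = w"
  by (cases "w = z") (simp_all add: cusp_param_def cusp_map_def)

lemma cusp_map_in_curve:
  assumes "0 < p" "w \<in> ball z r"
  shows "cusp_map p z w \<in> cusp_curve p r"
proof -
  have "norm (w - z) < r"
    using assms(2) by (simp add: dist_norm norm_minus_commute)
  then have "norm (w - z) ^ p < r ^ p"
    using assms(1) by (intro power_strict_mono) auto
  moreover have "((w - z) ^ Suc p) ^ p = ((w - z) ^ p) ^ Suc p"
    by (simp only: mult.commute flip: power_mult)
  ultimately show ?thesis
    unfolding cusp_curve_def cusp_disc_def cusp_map_def mem_Collect_eq fst_conv snd_conv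
    by (simp only: norm_power simp_thms)
qed

lemma cusp_curve_param:
  assumes "v \<in> cusp_curve p r" "0 < p" "0 < r"
  shows "cusp_map p z (cusp_param z v) = v" "cusp_param z v \<in> ball z r"
    "norm (cusp_param z v - z) = root p (norm (fst v))"
proof -
  obtain x y where v: "v = (x, y)" by (cases v)
  define t where "t = y / x"
  have xy: "norm x < r ^ p" "y ^ p = x ^ Suc p"
    using assms(1) by (auto simp: v cusp_curve_def cusp_disc_def)
  have t: "t ^ p = x" "t ^ Suc p = y"
  proof -
    show 1: "t ^ p = x"
      using xy(2) \<open>0 < p\<close> by (cases "x = 0") (simp_all add: t_def power_divide)
    show "t ^ Suc p = y"
      using xy(2) \<open>0 < p\<close> unfolding power_Suc2 1 by (cases "x = 0") (simp_all add: t_def)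
  qed
  have par: "cusp_param z v = z + t"
    by (simp add: cusp_param_def v t_def)
  show "cusp_map p z (cusp_param z v) = v"
    unfolding par using t by (simp add: cusp_map_def v)
  have "norm t ^ p < r ^ p" using xy(1) unfolding t(1)[symmetric] norm_power .
  then have "norm t < r"
    using \<open>0 < r\<close> by (intro power_less_imp_less_base[of "norm t" p r]) auto
  then show "cusp_param z v \<in> ball z r"
    by (simp add: par dist_norm)
  have "root p (norm t ^ p) = norm t"
    using \<open>0 < p\<close> by (simp add: real_root_power_cancel)
  then show "norm (cusp_param z v - z) = root p (norm (fst v))"
    unfolding par by (simp add: v t(1)[symmetric] norm_power)
qed

text \<open>
  At the singular point itself the quotient \<open>y/x\<close> has no limit a priori; on the curve its modulus is
  the \<open>p\<close>-th root of \<open>|x|\<close>.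
\<close>

lemma continuous_on_cusp_param:
  assumes "0 < p" "0 < r"
  shows "continuous_on (cusp_curve p r) (cusp_param z)"
  unfolding continuous_on_def
proof
  fix v assume v: "v \<in> cusp_curve p r"
  show "(cusp_param z \<longlongrightarrow> cusp_param z v) (at v within cusp_curve p r)"
  proof (cases "fst v = 0")
    case False
    then show ?thesis unfolding cusp_param_def by (intro tendsto_intros)
  next
    case True
    have "((\<lambda>v. root p (norm (fst v))) \<longlongrightarrow> root p (norm (fst v))) (at v within cusp_curve p r)"
      by (intro tendsto_intros)
    moreover have "\<forall>\<^sub>F v in at v within cusp_curve p r.
        root p (norm (fst v)) = norm (cusp_param z v - z)"
      unfolding eventually_at_filter
      using cusp_curve_param(3)[OF _ assms] by (intro always_eventually) simp
    ultimately have "((\<lambda>v. norm (cusp_param z v - z)) \<longlongrightarrow> root p (norm (fst v))) (at v within cusp_curve p r)"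
      by (rule Lim_transform_eventually)
    then have "((\<lambda>v. cusp_param z v - z) \<longlongrightarrow> 0) (at v within cusp_curve p r)"
      using True by (simp add: tendsto_norm_zero_iff)
    then have "(cusp_param z \<longlongrightarrow> z) (at v within cusp_curve p r)"
      by (rule LIM_zero_cancel)
    then show ?thesis
      using True by (simp add: cusp_param_def)
  qed
qed

lemma homeomorphic_map_cusp:
  assumes "0 < p" "0 < r"
  shows "homeomorphic_map (top_of_set (ball z r)) (top_of_set (emb2 ` cusp_curve p r))
           (\<lambda>w. emb2 (cusp_map p z w))"
  unfolding homeomorphic_map_maps
proof
  show "homeomorphic_maps (top_of_set (ball z r)) (top_of_set (emb2 ` cusp_curve p r))
           (\<lambda>w. emb2 (cusp_map p z w)) (\<lambda>q. cusp_param z (coord2 q))"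
    unfolding homeomorphic_maps_def
  proof (intro conjI)
    show "continuous_map (top_of_set (ball z r)) (top_of_set (emb2 ` cusp_curve p r))
           (\<lambda>w. emb2 (cusp_map p z w))"
      using cusp_map_in_curve[OF assms(1)]
        continuous_on_compose2[OF continuous_on_emb2 continuous_on_cusp_map subset_UNIV]
      by (auto simp: continuous_map_in_subtopology image_subset_iff)
    have "continuous_on (emb2 ` cusp_curve p r) (\<lambda>q. cusp_param z (coord2 q))"
      by (rule continuous_on_compose2[OF continuous_on_cusp_param[OF assms] continuous_on_coord2]) auto
    then show "continuous_map (top_of_set (emb2 ` cusp_curve p r)) (top_of_set (ball z r))
           (\<lambda>q. cusp_param z (coord2 q))"
      using cusp_curve_param(2)[OF _ assms]
      by (auto simp: continuous_map_in_subtopology image_subset_iff)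
    show "\<forall>w\<in>topspace (top_of_set (ball z r)). cusp_param z (coord2 (emb2 (cusp_map p z w))) = w"
      by (simp add: cusp_param_cusp_map[OF assms(1)])
    show "\<forall>q\<in>topspace (top_of_set (emb2 ` cusp_curve p r)).
        emb2 (cusp_map p z (cusp_param z (coord2 q))) = q"
      using cusp_curve_param(1)[OF _ assms] by auto
  qed
qed

lemma analytic_subset_cusp_curve:
  "analytic_subset (subtopology (Complex_space 2) (emb2 ` cusp_disc p r)) (holo 2)
     (emb2 ` cusp_curve p r)"
proof -
  let ?D = "emb2 ` cusp_disc p r"
  let ?e = "\<lambda>w :: nat \<Rightarrow> complex. w 1 ^ p - w 0 ^ Suc p"
  have "open (cusp_disc p r)" by (rule open_cusp_disc)
  have top: "topspace (subtopology (Complex_space 2) ?D) = ?D"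
    by (auto simp: Complex_space_2)
  have "openin (Complex_space 2) ?D"
    unfolding openin_Complex_space_2 using \<open>open (cusp_disc p r)\<close> by blast
  then have "openin (subtopology (Complex_space 2) ?D) ?D"
    by (simp add: openin_subtopology_refl openin_subset)
  moreover have "?e \<in> holo 2 ?D"
    unfolding holo_2_iff[OF \<open>open (cusp_disc p r)\<close>]
  proof
    fix v assume "v \<in> cusp_disc p r"
    have "cdiff2_at (\<lambda>v. snd v ^ p - fst v ^ Suc p) v"
      by (intro cdiff2_at_diff cdiff2_at_power cdiff2_at_fst cdiff2_at_snd)
    then show "cdiff2_at (\<lambda>v. emb2 v 1 ^ p - emb2 v 0 ^ Suc p) v"
      by simp
  qed
  moreover have "emb2 ` cusp_curve p r \<inter> ?D = {q \<in> ?D. \<forall>f\<in>{?e}. f q = 0}"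
    by (auto simp: cusp_curve_def)
  moreover have "emb2 ` cusp_curve p r \<subseteq> ?D"
    by (auto simp: cusp_curve_def)
  ultimately show ?thesis
    unfolding analytic_subset_def top
    by (intro conjI ballI exI[of _ ?D] exI[of _ "{?e}"]) simp_all
qed


section \<open>The singular plane\<close>

text \<open>
  The exponent \<open>p\<close> of the local model; the plane is singular exactly where it exceeds \<open>1\<close>. At \<open>0\<close> the
  first clause gives the value \<open>1\<close>.
\<close>

definition cusp_order :: "complex \<Rightarrow> nat" where
  "cusp_order z = (if z \<in> \<nat> then Suc (nat \<lfloor>Re z\<rfloor>) else 1)"

definition cusp_sheaf :: "complex set \<Rightarrow> (complex \<Rightarrow> complex) set" where
  "cusp_sheaf U = {g. \<forall>z\<in>U. cusp_germ (cusp_order z) z g}"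

lemma cusp_order_pos: "0 < cusp_order z"
  by (simp add: cusp_order_def)

lemma cusp_order_of_nat: "cusp_order (of_nat n) = Suc n"
  by (simp add: cusp_order_def)

lemma cusp_order_isolated:
  "\<exists>r>0. \<forall>w\<in>ball z r. w \<noteq> z \<longrightarrow> cusp_order w = 1"
proof -
  have "closed (\<nat> - {z} :: complex set)"
    by (rule closed_subset_Ints) (use Nats_subset_Ints in blast)
  then have "open (- (\<nat> - {z}))"
    by (rule open_Compl)
  moreover have "z \<in> - (\<nat> - {z})" by simp
  ultimately have "\<exists>r>0. ball z r \<subseteq> - (\<nat> - {z})"
    unfolding open_contains_ball by (rule bspec)
  then obtain r where r: "0 < r" "ball z r \<subseteq> - (\<nat> - {z})" by blast
  have "cusp_order w = 1" if "w \<in> ball z r" "w \<noteq> z" for w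
    using that r(2) by (auto simp: cusp_order_def)
  with r(1) show ?thesis by blast
qed

lemma cusp_sheaf_analytic: "g \<in> cusp_sheaf U \<Longrightarrow> g analytic_on U"
  unfolding analytic_on_analytic_at[of g U]
  by (auto simp: cusp_sheaf_def intro: cusp_germ_imp_analytic[OF _ cusp_order_pos])

lemma function_sheaf_cusp_sheaf: "function_sheaf euclidean cusp_sheaf"
  unfolding function_sheaf_def
proof (intro conjI allI impI)
  fix U f g
  assume "openin euclidean U \<and> f \<in> cusp_sheaf U \<and> (\<forall>x\<in>U. g x = f x)"
  then have U: "open U" and f: "f \<in> cusp_sheaf U" and eq: "\<forall>x\<in>U. f x = g x"
    by simp_all
  have "cusp_germ (cusp_order z) z g" if z: "z \<in> U" for z
  proof (rule cusp_germ_cong)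
    show "\<forall>\<^sub>F w in nhds z. f w = g w"
      using eventually_nhds_in_open[OF U z] by eventually_elim (use eq in blast)
    show "cusp_germ (cusp_order z) z f"
      using f z unfolding cusp_sheaf_def by blast
  qed
  then show "g \<in> cusp_sheaf U"
    unfolding cusp_sheaf_def by blast
qed (unfold cusp_sheaf_def, blast+)

text \<open>
  The embedding around \<open>z\<close> must describe the sheaf near the other points of the disc too, where the
  sheaf is defined by a different embedding. There both notions mean ordinary holomorphy: on the
  part of the curve with \<open>x \<noteq> 0\<close> the parameter is the restriction of the holomorphic function \<open>y/x\<close>.
\<close>

lemma cusp_sheaf_eq_model_sections:
  assumes r: "0 < r" "\<forall>w\<in>ball z r. w \<noteq> z \<longrightarrow> cusp_order w = 1"
    and W: "open W" "W \<subseteq> ball z r"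
  defines "\<phi> \<equiv> cusp_map (cusp_order z) z"
  shows "g \<in> cusp_sheaf W \<longleftrightarrow>
    (\<exists>h\<in>model_sections 2 ((\<lambda>w. emb2 (\<phi> w)) ` W). \<forall>x\<in>W. g x = h (emb2 (\<phi> x)))" (is "_ \<longleftrightarrow> ?R")
proof
  have inv: "cusp_param z (\<phi> w) = w" for w
    unfolding \<phi>_def by (rule cusp_param_cusp_map[OF cusp_order_pos])
  {
    assume g: "g \<in> cusp_sheaf W"
    have "(\<lambda>q. g (cusp_param z (coord2 q))) \<in> model_sections 2 (emb2 ` \<phi> ` W)"
      unfolding model_sections_2_iff coord2_emb2
    proof
      fix v assume "v \<in> \<phi> ` W"
      then obtain x where x: "x \<in> W" "v = \<phi> x" by blast
      show "\<exists>S G. open S \<and> v \<in> S \<and> (\<forall>s\<in>S. cdiff2_at G s) \<and>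
          (\<forall>q\<in>S \<inter> \<phi> ` W. g (cusp_param z q) = G q)"
      proof (cases "x = z")
        case True
        have "cusp_germ (cusp_order z) z g"
          using g x(1) True by (simp add: cusp_sheaf_def)
        then obtain S G where S: "open S" "(0, 0) \<in> S" "\<forall>v\<in>S. cdiff2_at G v"
          "\<forall>\<^sub>F w in nhds z. g w = G (\<phi> w)"
          unfolding cusp_germ_def \<phi>_def by blast
        obtain \<delta> where \<delta>: "0 < \<delta>" "\<And>w. dist w z < \<delta> \<Longrightarrow> g w = G (\<phi> w)"
          using S(4) unfolding eventually_nhds_metric by blast
        \<comment> \<open>Being close to \<open>z\<close> is the condition \<open>|x| < \<delta>\<^sup>p\<close> in the ambient plane.\<close>
        let ?S = "S \<inter> cusp_disc (cusp_order z) \<delta>"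
        have "open ?S" by (rule open_Int[OF S(1) open_cusp_disc])
        moreover have "v \<in> ?S"
          using S(2) \<delta>(1) cusp_map_base[OF cusp_order_pos]
          by (simp add: x(2) True \<phi>_def cusp_disc_def)
        moreover have "\<forall>q\<in>?S \<inter> \<phi> ` W. g (cusp_param z q) = G q"
        proof
          fix q assume q: "q \<in> ?S \<inter> \<phi> ` W"
          then obtain w where w: "w \<in> W" "q = \<phi> w" by blast
          have "norm (w - z) ^ cusp_order z < \<delta> ^ cusp_order z"
            using q by (simp add: w(2) \<phi>_def cusp_map_def cusp_disc_def norm_power)
          then have "dist w z < \<delta>"
            unfolding dist_norm by (rule power_less_imp_less_base) (use \<delta>(1) in simp)
          then show "g (cusp_param z q) = G q"
            using \<delta>(2) by (simp add: w(2) inv)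
        qed
        ultimately show ?thesis using S(3) by blast
      next
        case False
        have "cusp_order x = 1" using r(2) x(1) W(2) False by blast
        obtain T where T: "open T" "x \<in> T" "g holomorphic_on T"
          using cusp_sheaf_analytic[OF g] x(1) analytic_on_analytic_at analytic_at by metis
        let ?S = "{q. fst q \<noteq> 0} \<inter> cusp_param z -` T"
        have "open ({q :: complex \<times> complex. fst q \<noteq> 0})"
          by (intro open_Collect_neq continuous_intros)
        moreover have "continuous_on {q. fst q \<noteq> 0} (cusp_param z)"
          unfolding cusp_param_def by (intro continuous_intros) simp
        ultimately have "open ?S"
          using T(1) continuous_on_open_vimage by (metis Int_commute)
        moreover have "v \<in> ?S"
          using T(2) False by (simp add: x(2) inv) (simp add: \<phi>_def cusp_map_def)
        moreover have "\<forall>q\<in>?S. cdiff2_at (\<lambda>q. g (cusp_param z q)) q"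
        proof
          fix q assume q: "q \<in> ?S"
          have "cdiff2_at (cusp_param z) q"
            unfolding cusp_param_def
            using q by (intro cdiff2_at_add[OF cdiff2_at_const] cdiff2_at_divide) simp_all
          moreover have "g field_differentiable at (cusp_param z q)"
            using q T by (intro holomorphic_on_imp_differentiable_at[OF T(3,1)]) simp
          ultimately show "cdiff2_at (\<lambda>q. g (cusp_param z q)) q"
            by (rule cdiff2_at_compose[where g = g])
        qed
        ultimately show ?thesis by blast
      qed
    qed
    then show ?R
      unfolding image_image by (rule rev_bexI) (simp add: inv)
  next
    assume ?R
    then obtain h where h: "h \<in> model_sections 2 (emb2 ` \<phi> ` W)" "\<forall>x\<in>W. g x = h (emb2 (\<phi> x))"
      unfolding image_image by blast
    show "g \<in> cusp_sheaf W"
      unfolding cusp_sheaf_def mem_Collect_eq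
    proof
      fix x assume x: "x \<in> W"
      obtain S G where S: "open S" "\<phi> x \<in> S" "\<forall>s\<in>S. cdiff2_at G s"
        "\<forall>q\<in>S \<inter> \<phi> ` W. h (emb2 q) = G q"
        using h(1) x unfolding model_sections_2_iff by blast
      define T where "T = W \<inter> \<phi> -` S"
      have T: "open T" "x \<in> T"
        using W(1) S(1,2) x open_cusp_map_vimage unfolding T_def \<phi>_def by auto
      have gG: "g w = G (\<phi> w)" if "w \<in> T" for w
        using that h(2) S(4) by (simp add: T_def)
      have ev: "\<forall>\<^sub>F w in nhds x. g w = G (\<phi> w)"
        using eventually_nhds_in_open[OF T] by eventually_elim (rule gG)
      show "cusp_germ (cusp_order x) x g"
      proof (cases "x = z")
        case True
        have "(0, 0) \<in> S"
          using S(2) cusp_map_base[OF cusp_order_pos] unfolding True \<phi>_def by simp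
        then show ?thesis
          using S(1,3) ev unfolding cusp_germ_def True \<phi>_def by blast
      next
        case False
        then have 1: "cusp_order x = 1" using r(2) x W(2) by blast
        have "(\<lambda>w. G (\<phi> w)) holomorphic_on T"
          unfolding holomorphic_on_def
        proof
          fix w assume "w \<in> T"
          then have "cdiff2_at G (\<phi> w)" using S(3) by (simp add: T_def)
          then show "(\<lambda>w. G (\<phi> w)) field_differentiable at w within T"
            unfolding \<phi>_def
            by (rule field_differentiable_at_within[OF field_differentiable_cusp_map])
        qed
        then have "(\<lambda>w. G (\<phi> w)) analytic_on {x}"
          unfolding analytic_at using T by blast
        then have "g analytic_on {x}"
          by (subst analytic_at_cong[OF ev refl])
        then show ?thesis unfolding 1 by (rule cusp_germ_1I)
      qed
    qed
  }
qed

lemma reduced_complex_space_cusp_sheaf: "reduced_complex_space euclidean cusp_sheaf"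
  unfolding reduced_complex_space_def
proof (intro conjI ballI)
  show "Hausdorff_space (euclidean :: complex topology)"
    by simp
  show "function_sheaf euclidean cusp_sheaf"
    by (rule function_sheaf_cusp_sheaf)
  fix z :: complex
  obtain r where r: "0 < r" "\<forall>w\<in>ball z r. w \<noteq> z \<longrightarrow> cusp_order w = 1"
    using cusp_order_isolated[of z] by blast
  let ?p = "cusp_order z"
  have "openin (Complex_space 2) (emb2 ` cusp_disc ?p r)"
    unfolding openin_Complex_space_2 using open_cusp_disc by blast
  moreover have "subtopology (Complex_space 2) (emb2 ` cusp_curve ?p r) = top_of_set (emb2 ` cusp_curve ?p r)"
    unfolding Complex_space_2 subtopology_subtopology
    by (intro arg_cong[of _ _ top_of_set]) blast
  ultimately have "local_embedding euclidean cusp_sheaf (ball z r) 2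
      (emb2 ` cusp_disc ?p r) (emb2 ` cusp_curve ?p r) (\<lambda>w. emb2 (cusp_map ?p z w))"
    unfolding local_embedding_def
    using cusp_sheaf_eq_model_sections[OF r] analytic_subset_cusp_curve
      homeomorphic_map_cusp[OF cusp_order_pos r(1)]
    by (simp add: open_openin[symmetric])
  moreover have "z \<in> ball z r" using r(1) by simp
  ultimately show "\<exists>U m D A \<phi>. z \<in> U \<and> local_embedding euclidean cusp_sheaf U m D A \<phi>"
    by blast
qed


section \<open>Entire functions that are flat at the cusps\<close>

definition flat_at :: "(complex \<Rightarrow> complex) \<Rightarrow> complex \<Rightarrow> nat \<Rightarrow> bool" where
  "flat_at g z n \<longleftrightarrow> (\<exists>r v. 0 < r \<and> v holomorphic_on ball z r \<and>
     (\<forall>w\<in>ball z r. g w = (w - z) ^ n * v w))"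

lemma flat_at_mult:
  assumes "flat_at g z n" "q holomorphic_on UNIV"
  shows "flat_at (\<lambda>w. g w * q w) z n"
proof -
  obtain r v where *: "0 < r" "v holomorphic_on ball z r" "\<forall>w\<in>ball z r. g w = (w - z) ^ n * v w"
    using assms(1) unfolding flat_at_def by blast
  have "(\<lambda>w. v w * q w) holomorphic_on ball z r"
    using assms(2) *(2) by (intro holomorphic_on_mult) (auto intro: holomorphic_on_subset)
  with *(1,3) show ?thesis
    unfolding flat_at_def by (intro exI[of _ r] exI[of _ "\<lambda>w. v w * q w"]) (simp add: mult.assoc)
qed

text \<open>
  The order of divisibility of \<open>P - P z\<close> is raised one step at a time: if \<open>P - P z = t\<^sup>j u\<close> with
  \<open>1 \<le> j \<le> n\<close>, then \<open>P' = j t\<^sup>j\<^sup>-\<^sup>1 u + t\<^sup>j u'\<close> is divisible by \<open>t\<^sup>n\<close>, so \<open>u\<close> vanishes at \<open>z\<close> and a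
  further factor \<open>t\<close> splits off.
\<close>

lemma flat_at_primitive:
  assumes v: "v holomorphic_on ball z r" and r: "0 < r"
    and P: "\<And>w. w \<in> ball z r \<Longrightarrow> (P has_field_derivative (w - z) ^ n * v w) (at w)"
  shows "\<exists>u. u holomorphic_on ball z r \<and> (\<forall>w\<in>ball z r. P w = P z + (w - z) ^ n * u w)"
proof -
  have z: "z \<in> ball z r" using r by simp
  have "j \<le> n \<Longrightarrow> \<exists>u. u holomorphic_on ball z r \<and> (\<forall>w\<in>ball z r. P w = P z + (w - z) ^ j * u w)" for j
  proof (induction j)
    case 0
    have "P holomorphic_on ball z r"
      using P by (intro holomorphic_onI) (auto simp: field_differentiable_def intro: has_field_derivative_at_within)
    then have "(\<lambda>w. P w - P z) holomorphic_on ball z r"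
      by (intro holomorphic_intros)
    then show ?case by (intro exI[of _ "\<lambda>w. P w - P z"]) simp
  next
    case (Suc j)
    then obtain u where u: "u holomorphic_on ball z r"
      "\<And>w. w \<in> ball z r \<Longrightarrow> P w = P z + (w - z) ^ j * u w" by auto
    have "u z = 0"
    proof (cases "j = 0")
      case True
      then show ?thesis using u(2)[OF z] by simp
    next
      case False
      then obtain i where i: "j = Suc i" by (cases j) auto
      \<comment> \<open>Comparing the two expressions for the derivative of \<open>P\<close> and cancelling \<open>(w - z) ^ i\<close>.\<close>
      let ?k = "\<lambda>w. of_nat j * u w + (w - z) * deriv u w - (w - z) ^ (n - i) * v w"
      have "?k w = 0" if w: "w \<in> ball z r" "w \<noteq> z" for w
      proof -
        have "(u has_field_derivative deriv u w) (at w)"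
          using u(1) w(1) by (intro holomorphic_derivI) auto
        then have "((\<lambda>w. P z + (w - z) ^ j * u w) has_field_derivative
            (w - z) ^ i * (of_nat j * u w + (w - z) * deriv u w)) (at w)"
        proof -
          have "((\<lambda>w. (w - z) ^ Suc i) has_field_derivative (1 + of_nat i) * (1 * (w - z) ^ i)) (at w)"
            by (rule DERIV_power_Suc) (auto intro!: derivative_eq_intros)
          from DERIV_add[OF DERIV_const DERIV_mult[OF this \<open>(u has_field_derivative _) _\<close>], of "P z"]
          show ?thesis unfolding i by (simp add: algebra_simps)
        qed
        moreover have "((\<lambda>w. P z + (w - z) ^ j * u w) has_field_derivative (w - z) ^ n * v w) (at w)"
          using P[OF w(1)] open_ball w(1) u(2)
          by (rule has_field_derivative_transform_within_open)
        ultimately have "(w - z) ^ i * (of_nat j * u w + (w - z) * deriv u w) = (w - z) ^ n * v w"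
          by (rule DERIV_unique)
        also have "(w - z) ^ n = (w - z) ^ i * (w - z) ^ (n - i)"
          using Suc.prems i by (simp flip: power_add)
        finally show ?thesis using w(2) by simp
      qed
      then have "\<forall>\<^sub>F w in at z. ?k w = 0"
        using r unfolding eventually_at by (intro exI[of _ r]) (auto simp: dist_commute)
      then have "(?k \<longlongrightarrow> 0) (at z)"
        by (rule tendsto_eventually)
      moreover have "(?k \<longlongrightarrow> ?k z) (at z)"
      proof -
        have "continuous_on (ball z r) ?k"
          using u(1) v by (intro holomorphic_on_imp_continuous_on holomorphic_intros) auto
        then have "isCont ?k z"
          using z by (simp only: continuous_on_eq_continuous_at[OF open_ball])
        then show ?thesis
          unfolding isCont_def .
      qed
      ultimately have "?k z = 0"
        by (intro tendsto_unique[of "at z" ?k]) simp_all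
      moreover have "n - i > 0" using Suc.prems i by simp
      ultimately show ?thesis using False by (simp add: power_0_left)
    qed
    define u' where "u' = (\<lambda>w. if w = z then deriv u z else u w / (w - z))"
    have "u' holomorphic_on ball z r"
      using u(1) open_ball
      by (rule pole_theorem_open_0[where a = z]) (auto simp: u'_def \<open>u z = 0\<close>)
    moreover have "P w = P z + (w - z) ^ Suc j * u' w" if "w \<in> ball z r" for w
      using u(2)[OF that] by (cases "w = z") (simp_all add: u'_def \<open>u z = 0\<close>)
    ultimately show ?case by blast
  qed
  then show ?thesis by blast
qed

text \<open>
  For \<open>p = cusp_order z\<close>, the exponent \<open>p\<^sup>2\<close> is the one that makes \<open>cusp_germ_if_high_order\<close> applicable.
\<close>

definition flat_at_cusps :: "(complex \<Rightarrow> complex) \<Rightarrow> bool" where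
  "flat_at_cusps g \<longleftrightarrow> g holomorphic_on UNIV \<and>
     (\<forall>z. cusp_order z \<noteq> 1 \<longrightarrow> flat_at g z (cusp_order z * cusp_order z))"

lemma flat_at_cusps_mult:
  "flat_at_cusps g \<Longrightarrow> q holomorphic_on UNIV \<Longrightarrow> flat_at_cusps (\<lambda>z. g z * q z)"
  unfolding flat_at_cusps_def by (auto intro: flat_at_mult holomorphic_on_mult)

lemma cusp_sheaf_UNIV_I:
  assumes "g holomorphic_on UNIV"
    and "\<And>z. cusp_order z \<noteq> 1 \<Longrightarrow> cusp_germ (cusp_order z) z g"
  shows "g \<in> cusp_sheaf UNIV"
  unfolding cusp_sheaf_def mem_Collect_eq
proof
  fix z
  have "g analytic_on {z}"
    unfolding analytic_at using assms(1) open_UNIV by blast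
  from cusp_germ_1I[OF this] show "cusp_germ (cusp_order z) z g"
    using assms(2)[of z] by (cases "cusp_order z = 1") simp_all
qed

lemma flat_at_cusps_imp_section:
  assumes "flat_at_cusps g"
  shows "g \<in> cusp_sheaf UNIV"
proof (rule cusp_sheaf_UNIV_I)
  show "g holomorphic_on UNIV" using assms by (simp add: flat_at_cusps_def)
  fix z assume "cusp_order z \<noteq> 1"
  then have "flat_at g z (cusp_order z * cusp_order z)"
    using assms by (simp add: flat_at_cusps_def)
  then obtain r v where *: "0 < r" "v holomorphic_on ball z r"
    "\<forall>w\<in>ball z r. g w = (w - z) ^ (cusp_order z * cusp_order z) * v w"
    unfolding flat_at_def by blast
  show "cusp_germ (cusp_order z) z g"
    by (rule cusp_germ_if_high_order[OF *(2) cusp_order_pos *(1), where c = 0]) (use *(3) in simp)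
qed

lemma flat_primitive_is_section:
  assumes "flat_at_cusps g" "\<And>z. (P has_field_derivative g z) (at z)"
  shows "P \<in> cusp_sheaf UNIV"
proof (rule cusp_sheaf_UNIV_I)
  show "P holomorphic_on UNIV"
    using assms(2) by (auto simp: holomorphic_on_def field_differentiable_def)
  fix z assume "cusp_order z \<noteq> 1"
  then have "flat_at g z (cusp_order z * cusp_order z)"
    using assms by (simp add: flat_at_cusps_def)
  then obtain r v where *: "0 < r" "v holomorphic_on ball z r"
    "\<forall>w\<in>ball z r. g w = (w - z) ^ (cusp_order z * cusp_order z) * v w"
    unfolding flat_at_def by blast
  have "(P has_field_derivative (w - z) ^ (cusp_order z * cusp_order z) * v w) (at w)"
    if "w \<in> ball z r" for w
    using assms(2)[of w] *(3) that by simp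
  from flat_at_primitive[OF *(2,1) this]
  obtain u where u: "u holomorphic_on ball z r"
    "\<forall>w\<in>ball z r. P w = P z + (w - z) ^ (cusp_order z * cusp_order z) * u w" by blast
  show "cusp_germ (cusp_order z) z P"
    by (rule cusp_germ_if_high_order[OF u(1) cusp_order_pos *(1), where c = "P z"]) (use u(2) in simp)
qed

lemma cusp_order_neq_1_iff: "cusp_order z \<noteq> 1 \<longleftrightarrow> (\<exists>n\<ge>1. z = of_nat n)"
proof
  assume *: "cusp_order z \<noteq> 1"
  then have "z \<in> \<nat>" by (meson cusp_order_def)
  then obtain n where "z = of_nat n" by (auto elim: Nats_cases)
  with * show "\<exists>n\<ge>1. z = of_nat n"
    by (cases n) (simp_all add: cusp_order_def exI[of _ n])
qed (auto simp: cusp_order_of_nat)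

text \<open>
  The factor that turns entire functions into global sections. Its sign on the real axis, where all
  the cusps lie, makes the increments of its primitives controllable.
\<close>

definition cusp_weight :: "(complex \<Rightarrow> complex) \<Rightarrow> bool" where
  "cusp_weight H \<longleftrightarrow> flat_at_cusps H \<and> (\<forall>z. H z = 0 \<longleftrightarrow> cusp_order z \<noteq> 1) \<and>
     (\<forall>s. H (of_real s) = of_real (Re (H (of_real s))) \<and> 0 \<le> Re (H (of_real s)))"

lemma cusp_weightD:
  assumes "cusp_weight H"
  shows "flat_at_cusps H" "\<And>z. H z = 0 \<longleftrightarrow> cusp_order z \<noteq> 1"
    "\<And>s. H (of_real s) = of_real (Re (H (of_real s)))" "\<And>s. 0 \<le> Re (H (of_real s))"
    "H holomorphic_on UNIV"
  using assms unfolding cusp_weight_def flat_at_cusps_def by blast+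

lemma cusp_weight_exists: "\<exists>H. cusp_weight H"
proof -
  let ?A = "{z. cusp_order z \<noteq> 1}"
  have A: "?A = of_nat ` {1..}"
    unfolding cusp_order_neq_1_iff by auto
  have infinite: "infinite ?A"
    unfolding A by (subst finite_image_iff) (auto simp: inj_on_def infinite_Ici)
  have closed: "closed ?A"
    unfolding A by (rule closed_subset_Ints) auto
  have finite: "finite (?A \<inter> cball 0 r)" for r
  proof (rule finite_subset)
    show "?A \<inter> cball 0 r \<subseteq> of_nat ` {..nat \<lfloor>r\<rfloor>}"
      unfolding A by (auto simp: le_nat_floor)
  qed simp
  obtain a :: "nat \<Rightarrow> complex" where a: "range a = ?A" "filterlim a at_infinity at_top"
    "\<And>z. z \<in> ?A \<Longrightarrow> finite (a -` {z}) \<and> card (a -` {z}) = cusp_order z * cusp_order z"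
    using sequence_of_sparse_set_exists'[OF infinite closed finite,
        of "\<lambda>z. cusp_order z * cusp_order z"] cusp_order_pos by (metis nat_0_less_mult_iff)
  interpret weierstrass_product' a
  proof
    show "a n \<noteq> 0" for n
    proof
      assume "a n = 0"
      then have "0 \<in> ?A" using a(1) by (metis rangeI)
      then show False using cusp_order_of_nat[of 0] by simp
    qed
    show "filterlim a at_infinity at_top" by (rule a(2))
    show "finite (a -` {z})" if "z \<in> range a" for z
      using a(1,3) that by blast
  qed
  define F where "F = f"
  have F: "F holomorphic_on UNIV" unfolding F_def by (rule holomorphic)
  have F0: "F z = 0 \<longleftrightarrow> cusp_order z \<noteq> 1" for z
    unfolding F_def zero a(1) by simp
  have F_flat: "flat_at F z (cusp_order z * cusp_order z)" if z: "cusp_order z \<noteq> 1" for z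
  proof -
    have "\<exists>w\<in>UNIV. F w \<noteq> 0"
      using F0[of 0] cusp_order_of_nat[of 0] by auto
    from zorder_exist_zero[OF F open_UNIV connected_UNIV UNIV_I this, of z]
    obtain r where r: "0 < r" "zor_poly F z holomorphic_on cball z r"
      "\<forall>w\<in>cball z r. F w = zor_poly F z w * (w - z) ^ nat (zorder F z)" by blast
    have "nat (zorder F z) = cusp_order z * cusp_order z"
      unfolding F_def zorder using a(3)[of z] z by (simp flip: of_nat_mult)
    then show ?thesis
      unfolding flat_at_def using r
      by (intro exI[of _ r] exI[of _ "zor_poly F z"])
         (auto intro: holomorphic_on_subset simp: mult.commute)
  qed
  \<comment> \<open>Multiplying by the reflection makes the function non-negative on the real axis and, as the
    zeros of \<open>F\<close> are real, creates no new ones.\<close>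
  define H where "H = (\<lambda>z. F z * (cnj \<circ> F \<circ> cnj) z)"
  have "(cnj \<circ> F \<circ> cnj) holomorphic_on UNIV"
    using F by (intro holomorphic_on_compose_cnj_cnj holomorphic_on_subset[OF F]) auto
  moreover have "flat_at_cusps F"
    using F F_flat by (simp add: flat_at_cusps_def)
  ultimately have "flat_at_cusps H"
    unfolding H_def by (rule flat_at_cusps_mult[rotated])
  moreover have "H z = 0 \<longleftrightarrow> cusp_order z \<noteq> 1" for z
  proof -
    have "cusp_order (cnj z) \<noteq> 1 \<longleftrightarrow> cusp_order z \<noteq> 1"
      unfolding cusp_order_neq_1_iff by (metis complex_cnj_cnj complex_cnj_of_nat)
    then show ?thesis by (simp add: H_def F0)
  qed
  moreover have real: "H (of_real s) = of_real ((norm (F (of_real s)))\<^sup>2)" for s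
    unfolding H_def comp_def complex_cnj_complex_of_real by (rule complex_norm_square[symmetric])
  have "H (of_real s) = of_real (Re (H (of_real s)))" "0 \<le> Re (H (of_real s))" for s
    unfolding real by simp_all
  ultimately have "cusp_weight H"
    unfolding cusp_weight_def by (intro conjI allI)
  then show ?thesis by blast
qed


section \<open>The singular plane is a Stein curve\<close>

lemma primitive_increment:
  fixes P Q :: "complex \<Rightarrow> complex" and a b c d m :: real
  assumes P: "\<And>z. (P has_field_derivative Q z) (at z)"
    and le: "a \<le> c" "c \<le> d" "d \<le> b"
    and nonneg: "\<And>s. a \<le> s \<Longrightarrow> s \<le> b \<Longrightarrow> 0 \<le> Re (Q (of_real s))"
    and m: "\<And>s. c \<le> s \<Longrightarrow> s \<le> d \<Longrightarrow> m \<le> Re (Q (of_real s))"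
  shows "m * (d - c) \<le> Re (P (of_real b)) - Re (P (of_real a))"
proof -
  define \<phi> where "\<phi> = (\<lambda>s. Re (P (of_real s)))"
  have \<phi>: "(\<phi> has_real_derivative Re (Q (of_real s))) (at s)" for s
    using bounded_linear.has_vector_derivative[OF bounded_linear_Re
        has_vector_derivative_real_field[OF P[of "of_real s"]]]
    unfolding \<phi>_def has_real_derivative_iff_has_vector_derivative .
  have "\<phi> a \<le> \<phi> c"
    by (rule DERIV_nonneg_imp_nondecreasing[OF le(1)]) (use \<phi> nonneg le in force)
  moreover have "\<phi> d \<le> \<phi> b"
    by (rule DERIV_nonneg_imp_nondecreasing[OF le(3)]) (use \<phi> nonneg le in force)
  moreover have "\<phi> c - m * c \<le> \<phi> d - m * d"
  proof (rule DERIV_nonneg_imp_nondecreasing[OF le(2)])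
    fix s assume s: "c \<le> s" "s \<le> d"
    have "((\<lambda>s. \<phi> s - m * s) has_real_derivative Re (Q (of_real s)) - m) (at s)"
      using \<phi>[of s] by (auto intro!: derivative_eq_intros)
    then show "\<exists>y. ((\<lambda>s. \<phi> s - m * s) has_real_derivative y) (at s) \<and> 0 \<le> y"
      using m[OF s] by (intro exI[of _ "Re (Q (of_real s)) - m"]) simp
  qed
  ultimately show ?thesis
    unfolding \<phi>_def by (simp add: algebra_simps)
qed

lemma entire_primitive:
  assumes "Q holomorphic_on UNIV"
  shows "\<exists>P. \<forall>z. (P has_field_derivative Q z) (at z)"
proof (rule holomorphic_convex_primitive'[OF convex_UNIV open_UNIV assms])
  fix P assume "\<And>z. z \<in> UNIV \<Longrightarrow> (P has_field_derivative Q z) (at z)"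
  then show ?thesis by (intro exI[of _ P]) simp
qed

text \<open>
  An interval to the left of the integer \<open>n\<close> that contains no cusp. A primitive gains a definite
  amount over it before it reaches \<open>n\<close>.
\<close>

lemma cusp_weight_lower_bound:
  assumes "cusp_weight H"
  shows "\<exists>\<mu>>0. \<forall>s\<in>{real n - 1/2..real n - 1/4}. \<mu> \<le> Re (H (of_real s))"
proof -
  note H = cusp_weightD[OF assms]
  let ?I = "{real n - 1/2..real n - 1/4}"
  have "continuous_on (of_real ` ?I) H"
    by (rule continuous_on_subset[OF holomorphic_on_imp_continuous_on[OF H(5)] subset_UNIV])
  then have "continuous_on ?I (\<lambda>s. H (of_real s))"
    by (rule continuous_on_compose2[OF _ continuous_on_of_real_id subset_refl])
  then have "continuous_on ?I (\<lambda>s. Re (H (of_real s)))"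
    by (rule continuous_on_Re)
  from continuous_attains_inf[OF compact_Icc _ this]
  obtain t where t: "t \<in> ?I" "\<forall>s\<in>?I. Re (H (of_real t)) \<le> Re (H (of_real s))"
    by auto
  have "complex_of_real t \<noteq> of_nat k" for k
  proof
    assume "complex_of_real t = of_nat k"
    then have "complex_of_real t = of_real (real k)" by simp
    then have "t = real k" by (simp only: of_real_eq_iff)
    then have "real n - 1/2 \<le> real k" "real k \<le> real n - 1/4" using t(1) by auto
    then have "n \<le> k" "k < n" by linarith+
    then show False by simp
  qed
  then have "cusp_order (of_real t) = 1"
    using cusp_order_neq_1_iff[of "of_real t"] by blast
  then have "H (of_real t) \<noteq> 0"
    by (simp only: H(2) not_True_eq_False not_False_eq_True)
  have "Re (H (of_real t)) \<noteq> 0"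
  proof
    assume 0: "Re (H (of_real t)) = 0"
    have "H (of_real t) = of_real (Re (H (of_real t)))" by (rule H(3))
    also have "\<dots> = 0" unfolding 0 by (rule of_real_0)
    finally show False using \<open>H (of_real t) \<noteq> 0\<close> by contradiction
  qed
  with H(4)[of t] have "0 < Re (H (of_real t))" by linarith
  with t(2) show ?thesis by blast
qed

text \<open>
  If \<open>H x \<noteq> 0\<close>, then \<open>H(w) (w - y)\<close> separates \<open>x\<close> from \<open>y\<close>. If both points are cusps, they are real
  and a primitive of \<open>H\<close> has a larger real part at the larger of them.
\<close>

lemma holomorphically_separable_cusp_sheaf: "holomorphically_separable euclidean cusp_sheaf"
proof -
  obtain H where weight: "cusp_weight H"
    using cusp_weight_exists by blast
  note H = cusp_weightD[OF weight]
  have smooth: "\<exists>f\<in>cusp_sheaf UNIV. f x \<noteq> f y" if "x \<noteq> y" "H x \<noteq> 0" for x y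
  proof
    show "(\<lambda>w. H w * (w - y)) \<in> cusp_sheaf UNIV"
      by (intro flat_at_cusps_imp_section flat_at_cusps_mult H(1) holomorphic_intros)
    show "H x * (x - y) \<noteq> H y * (y - y)" using that by simp
  qed
  have cusps: "\<exists>f\<in>cusp_sheaf UNIV. f (of_nat m) \<noteq> f (of_nat n)" if mn: "m < n" for m n :: nat
  proof -
    obtain P where P: "\<forall>z. (P has_field_derivative H z) (at z)"
      using entire_primitive[OF H(5)] by blast
    obtain \<mu> where \<mu>: "0 < \<mu>"
      "\<forall>s\<in>{real n - 1/2..real n - 1/4}. \<mu> \<le> Re (H (of_real s))"
      using cusp_weight_lower_bound[OF weight, of n] by blast
    have "\<mu> * ((real n - 1/4) - (real n - 1/2)) \<le> Re (P (of_real (real n))) - Re (P (of_real (real m)))"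
    proof (rule primitive_increment)
      show "(P has_field_derivative H z) (at z)" for z
        using P by blast
      show "\<mu> \<le> Re (H (of_real s))" if "real n - 1/2 \<le> s" "s \<le> real n - 1/4" for s
        using \<mu>(2) that by simp
      show "real m \<le> real n - 1/2" using mn by simp
      show "0 \<le> Re (H (of_real s))" for s by (rule H(4))
    qed simp_all
    then have "\<mu> / 4 \<le> Re (P (of_nat n)) - Re (P (of_nat m))"
      by simp
    then have "Re (P (of_nat m)) \<noteq> Re (P (of_nat n))"
      using \<mu>(1) by linarith
    then have "P (of_nat m) \<noteq> P (of_nat n)" by force
    moreover have "P \<in> cusp_sheaf UNIV"
      by (rule flat_primitive_is_section[OF H(1) P[rule_format]])
    ultimately show ?thesis by blast
  qed
  have "\<exists>f\<in>cusp_sheaf UNIV. f x \<noteq> f y" if ne: "x \<noteq> y" for x y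
  proof (cases "H x = 0 \<and> H y = 0")
    case True
    then have "cusp_order x \<noteq> 1" "cusp_order y \<noteq> 1"
      using H(2) by blast+
    then obtain m n where mn: "x = of_nat m" "y = of_nat n"
      unfolding cusp_order_neq_1_iff by blast
    then have "m \<noteq> n" using ne by blast
    then consider "m < n" | "n < m" by linarith
    then show ?thesis
    proof cases
      case 1
      show ?thesis unfolding mn by (rule cusps[OF 1])
    next
      case 2
      show ?thesis unfolding mn using cusps[OF 2] by (metis (no_types))
    qed
  next
    case False
    then consider "H x \<noteq> 0" | "H y \<noteq> 0" by blast
    then show ?thesis
    proof cases
      case 1
      show ?thesis by (rule smooth[OF ne 1])
    next
      case 2
      show ?thesis using smooth[OF ne[symmetric] 2] by (metis (no_types))
    qed
  qed
  then show ?thesis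
    unfolding holomorphically_separable_def by simp
qed

text \<open>
  Off the cusps the sections \<open>H(z) z\<^sup>n\<close> grow faster than on the disc of radius \<open>R\<close>. They vanish at the
  cusps, but there their primitives take over: on the real axis nothing cancels in the integral.
\<close>

lemma section_exceeding_bound:
  assumes "1 \<le> R" "R + 1 < norm x"
  shows "\<exists>g M. g \<in> cusp_sheaf UNIV \<and> (\<forall>w. norm w \<le> R \<longrightarrow> norm (g w) \<le> M) \<and> M < norm (g x)"
proof -
  obtain H where weight: "cusp_weight H"
    using cusp_weight_exists by blast
  note H = cusp_weightD[OF weight]
  have "compact (H ` cball 0 R)"
    by (intro compact_continuous_image holomorphic_on_imp_continuous_on holomorphic_on_subset[OF H(5)]) auto
  then have "bounded (H ` cball 0 R)"
    by (rule compact_imp_bounded)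
  then obtain B where B: "0 < B" "\<forall>w\<in>cball 0 R. norm (H w) \<le> B"
    unfolding bounded_pos ball_simps by blast
  have bound: "norm (H w * w ^ n) \<le> B * R ^ n" if "norm w \<le> R" for w n
    unfolding norm_mult norm_power
  proof (rule mult_mono)
    show "norm (H w) \<le> B" using B(2) that by simp
    show "norm w ^ n \<le> R ^ n" using that by (simp add: power_mono)
  qed (use B(1) in simp_all)
  have large: "\<exists>n. C * R ^ n < c * S ^ n" if "0 < c" "R < S" for C c S :: real
  proof -
    have "1 < S / R" using that \<open>1 \<le> R\<close> by simp
    then obtain n where "C / c < (S / R) ^ n" using real_arch_pow by blast
    then show ?thesis
      using that \<open>1 \<le> R\<close> by (intro exI[of _ n]) (simp add: power_divide field_simps)
  qed
  have flat: "flat_at_cusps (\<lambda>z. H z * z ^ n)" for n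
    by (intro flat_at_cusps_mult H(1) holomorphic_intros)
  show ?thesis
  proof (cases "H x = 0")
    case False
    obtain n where n: "B * R ^ n < norm (H x) * norm x ^ n"
      using large[of "norm (H x)" "norm x" B] False assms(2) by auto
    show ?thesis
    proof (intro exI conjI allI impI)
      show "(\<lambda>z. H z * z ^ n) \<in> cusp_sheaf UNIV"
        by (rule flat_at_cusps_imp_section[OF flat])
      show "norm (H w * w ^ n) \<le> B * R ^ n" if "norm w \<le> R" for w
        by (rule bound[OF that])
      show "B * R ^ n < norm (H x * x ^ n)"
        using n by (simp add: norm_mult norm_power)
    qed
  next
    case True
    then obtain k where k: "x = of_nat k"
      unfolding H(2) cusp_order_neq_1_iff by blast
    then have Rk: "R + 1 < real k" using assms(2) by simp
    obtain \<mu> where \<mu>: "0 < \<mu>"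
      "\<forall>s\<in>{real k - 1/2..real k - 1/4}. \<mu> \<le> Re (H (of_real s))"
      using cusp_weight_lower_bound[OF weight, of k] by blast
    obtain n where n: "(B * R) * R ^ n < (\<mu> / 4) * (real k - 1/2) ^ n"
      using large[of "\<mu> / 4" "real k - 1/2" "B * R"] \<mu>(1) Rk by auto
    have "(\<lambda>z. H z * z ^ n) holomorphic_on UNIV"
      using flat by (simp add: flat_at_cusps_def)
    from entire_primitive[OF this]
    obtain P0 where P0: "\<forall>z. (P0 has_field_derivative H z * z ^ n) (at z)" by blast
    define P where "P = (\<lambda>z. P0 z - P0 0)"
    have P: "(P has_field_derivative H z * z ^ n) (at z)" for z
      using DERIV_diff[OF P0[rule_format, of z] DERIV_const[of "P0 0"]] by (simp add: P_def)
    have "P 0 = 0" by (simp add: P_def)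
    have re: "Re (H (of_real s) * of_real s ^ n) = Re (H (of_real s)) * s ^ n" for s
      by (subst H(3)) (simp flip: of_real_power)
    show ?thesis
    proof (intro exI conjI allI impI)
      show "P \<in> cusp_sheaf UNIV"
        by (rule flat_primitive_is_section[OF flat P])
      show "norm (P w) \<le> (B * R) * R ^ n" if "norm w \<le> R" for w
      proof -
        have "norm (P w - P 0) \<le> (B * R ^ n) * norm (w - 0)"
        proof (rule field_differentiable_bound)
          show "convex (cball (0::complex) R)" by simp
          show "(P has_field_derivative H z * z ^ n) (at z within cball 0 R)" for z
            by (rule has_field_derivative_at_within[OF P])
          show "norm (H z * z ^ n) \<le> B * R ^ n" if "z \<in> cball 0 R" for z
            using bound that by simp
        qed (use that \<open>1 \<le> R\<close> in auto)
        also have "\<dots> \<le> (B * R ^ n) * R"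
          using that B(1) \<open>1 \<le> R\<close> by (intro mult_left_mono) auto
        finally show ?thesis
          using \<open>P 0 = 0\<close> by (simp add: mult_ac)
      qed
      have "(\<mu> * (real k - 1/2) ^ n) * ((real k - 1/4) - (real k - 1/2))
          \<le> Re (P (of_real (real k))) - Re (P (of_real 0))"
      proof (rule primitive_increment[OF P])
        show "0 \<le> Re (H (of_real s) * of_real s ^ n)" if "0 \<le> s" for s
          unfolding re using H(4) that by simp
        show "\<mu> * (real k - 1/2) ^ n \<le> Re (H (of_real s) * of_real s ^ n)"
          if s: "real k - 1/2 \<le> s" "s \<le> real k - 1/4" for s
          unfolding re
        proof (rule mult_mono)
          show "\<mu> \<le> Re (H (of_real s))" using \<mu>(2) s by simp
          show "(real k - 1/2) ^ n \<le> s ^ n"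
            using s Rk \<open>1 \<le> R\<close> by (intro power_mono) auto
          show "0 \<le> (real k - 1/2) ^ n"
            using Rk \<open>1 \<le> R\<close> by simp
        qed (rule H(4))
      qed (use Rk \<open>1 \<le> R\<close> in simp_all)
      then have "(\<mu> / 4) * (real k - 1/2) ^ n \<le> Re (P x)"
        using \<open>P 0 = 0\<close> by (simp add: k)
      then show "(B * R) * R ^ n < norm (P x)"
        using n complex_Re_le_cmod[of "P x"] by linarith
    qed
  qed
qed

lemma cusp_sheaf_continuous_on: "g \<in> cusp_sheaf U \<Longrightarrow> continuous_on U g"
  by (rule holomorphic_on_imp_continuous_on[OF analytic_imp_holomorphic[OF cusp_sheaf_analytic]])

lemma holomorphically_convex_cusp_sheaf: "holomorphically_convex euclidean cusp_sheaf"
  unfolding holomorphically_convex_def compactin_euclidean_iff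
proof (intro allI impI)
  fix K :: "complex set" assume "compact K"
  from compact_imp_bounded[OF this]
  obtain b where b: "\<forall>w\<in>K. norm w \<le> b"
    unfolding bounded_iff by (elim exE)
  define R where "R = max 1 b"
  have R: "1 \<le> R" "\<And>w. w \<in> K \<Longrightarrow> norm w \<le> R"
    using b by (simp_all add: R_def le_max_iff_disj)
  let ?hull = "holomorphic_hull euclidean cusp_sheaf K"
  have hull: "?hull = (\<Inter>f\<in>cusp_sheaf UNIV. {x. ereal (cmod (f x)) \<le> (SUP y\<in>K. ereal (cmod (f y)))})"
    by (auto simp: holomorphic_hull_def)
  have "closed ?hull"
    unfolding hull
  proof (intro closed_INT ballI)
    fix f assume "f \<in> cusp_sheaf UNIV"
    from continuous_on_ereal[OF continuous_on_norm[OF cusp_sheaf_continuous_on[OF this]]]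
    show "closed {x. ereal (cmod (f x)) \<le> (SUP y\<in>K. ereal (cmod (f y)))}"
      by (rule closed_Collect_le[OF _ continuous_on_const])
  qed
  moreover have "?hull \<subseteq> cball 0 (R + 1)"
  proof
    fix x assume x: "x \<in> ?hull"
    show "x \<in> cball 0 (R + 1)"
    proof (rule ccontr)
      assume "x \<notin> cball 0 (R + 1)"
      then have "R + 1 < norm x" by simp
      from section_exceeding_bound[OF R(1) this]
      obtain g M where g: "g \<in> cusp_sheaf UNIV" "\<forall>w. norm w \<le> R \<longrightarrow> norm (g w) \<le> M"
        "M < norm (g x)" by blast
      have "ereal (cmod (g x)) \<le> (SUP y\<in>K. ereal (cmod (g y)))"
        using x g(1) by (simp add: holomorphic_hull_def)
      also have "\<dots> \<le> ereal M"
      proof (rule SUP_least)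
        fix y assume "y \<in> K"
        from g(2)[rule_format, OF R(2)[OF this]] show "ereal (cmod (g y)) \<le> ereal M"
          by simp
      qed
      finally show False using g(3) by simp
    qed
  qed
  ultimately show "compact ?hull"
    unfolding compact_eq_bounded_closed by (intro conjI bounded_subset[OF bounded_cball])
qed

lemma analytic_subset_local:
  assumes "analytic_subset euclidean cusp_sheaf A"
  shows "\<exists>V F. open V \<and> p \<in> V \<and> F \<subseteq> cusp_sheaf V \<and> A \<inter> V = {x\<in>V. \<forall>f\<in>F. f x = 0}"
proof -
  have "\<forall>p. \<exists>V F. open V \<and> p \<in> V \<and> finite F \<and> F \<subseteq> cusp_sheaf V \<and>
      A \<inter> V = {x\<in>V. \<forall>f\<in>F. f x = 0}"
    using assms by (simp add: analytic_subset_def)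
  from spec[OF this, of p] show ?thesis by (elim exE conjE) (intro exI conjI)
qed

lemma analytic_subset_closed:
  assumes "analytic_subset euclidean cusp_sheaf A"
  shows "closed A"
  unfolding closure_subset_eq[symmetric]
proof
  fix p assume p: "p \<in> closure A"
  obtain V F where V: "open V" "p \<in> V" "F \<subseteq> cusp_sheaf V" "A \<inter> V = {x\<in>V. \<forall>f\<in>F. f x = 0}"
    using analytic_subset_local[OF assms, of p] by (elim exE conjE)
  have "f p = 0" if f: "f \<in> F" for f
  proof (rule ccontr)
    assume "f p \<noteq> 0"
    let ?W = "f -` (- {0}) \<inter> V"
    have "continuous_on V f"
      using f V(3) by (intro cusp_sheaf_continuous_on) (rule subsetD)
    then have "open ?W"
      using V(1) by (simp add: continuous_on_open_vimage open_Compl)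
    moreover have "p \<in> ?W" using V(2) \<open>f p \<noteq> 0\<close> by simp
    ultimately have "?W \<inter> A \<noteq> {}"
      using open_Int_closure_eq_empty[of ?W A] p by blast
    moreover have "?W \<inter> A \<subseteq> {x\<in>V. \<forall>f\<in>F. f x = 0}"
      unfolding V(4)[symmetric] by auto
    ultimately show False using f by auto
  qed
  then have "p \<in> A \<inter> V" unfolding V(4) using V(2) by simp
  then show "p \<in> A" by simp
qed

text \<open>
  Where an analytic set has interior points arbitrarily close to \<open>p\<close>, the identity theorem makes its
  local equations vanish around \<open>p\<close>. So the interior is closed, and the plane is connected.
\<close>

lemma analytic_subset_interior:
  assumes "analytic_subset euclidean cusp_sheaf A"
  shows "interior A = {} \<or> A = UNIV"
proof -
  have "closed (interior A)"
    unfolding closure_subset_eq[symmetric]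
  proof
    fix p assume p: "p \<in> closure (interior A)"
    obtain V F where V: "open V" "p \<in> V" "F \<subseteq> cusp_sheaf V" "A \<inter> V = {x\<in>V. \<forall>f\<in>F. f x = 0}"
      using analytic_subset_local[OF assms, of p] by (elim exE conjE)
    obtain r where r: "0 < r" "ball p r \<subseteq> V"
      using openE[OF V(1,2)] .
    let ?I = "interior A \<inter> ball p r"
    have "p \<in> ball p r" using r(1) by simp
    then have "?I \<noteq> {}"
      using open_Int_closure_eq_empty[of "ball p r" "interior A"] p by blast
    have "f w = 0" if f: "f \<in> F" and w: "w \<in> ball p r" for f w
    proof (rule analytic_continuation_open[of ?I "ball p r" f "\<lambda>_. 0"])
      have "f analytic_on V"
        using f V(3) by (intro cusp_sheaf_analytic) (rule subsetD)
      then show "f holomorphic_on ball p r"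
        by (rule holomorphic_on_subset[OF analytic_imp_holomorphic r(2)])
      show "f x = 0" if "x \<in> ?I" for x
      proof -
        have "x \<in> A \<inter> V" using that r(2) interior_subset[of A] by auto
        then show ?thesis unfolding V(4) using f by simp
      qed
    qed (use \<open>?I \<noteq> {}\<close> w in \<open>simp_all add: open_Int\<close>)
    then have "ball p r \<subseteq> A \<inter> V"
      unfolding V(4) using r(2) by auto
    then have "ball p r \<subseteq> interior A"
      by (intro interior_maximal) simp_all
    then show "p \<in> interior A" using \<open>p \<in> ball p r\<close> by (rule subsetD)
  qed
  then have "interior A = {} \<or> interior A = UNIV"
    using clopen[of "interior A"] by simp
  then show ?thesis
    using interior_subset[of A] by auto
qed

text \<open>
  Two proper analytic subsets are closed and nowhere dense, hence so is their union.
\<close>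

lemma irreducible_space_cusp_sheaf: "irreducible_space euclidean cusp_sheaf"
proof -
  have "A = UNIV \<or> B = UNIV"
    if A: "analytic_subset euclidean cusp_sheaf A" and B: "analytic_subset euclidean cusp_sheaf B"
      and "A \<union> B = UNIV" for A B
  proof (rule ccontr)
    assume "\<not> (A = UNIV \<or> B = UNIV)"
    then have "interior A = {}" "interior B = {}"
      using analytic_subset_interior[OF A] analytic_subset_interior[OF B] by simp_all
    then have "interior (A \<union> B) = {}"
      using interior_closed_Un_empty_interior[OF analytic_subset_closed[OF A], of B] by simp
    then show False using \<open>A \<union> B = UNIV\<close> by simp
  qed
  then show ?thesis unfolding irreducible_space_def by simp
qed

text \<open>
  The coordinate \<open>x = (w - z)\<^sup>p\<close> has \<open>z\<close> as its only zero; no equations at all cannot isolate a point,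
  as the plane has no isolated points.
\<close>

lemma local_dim_cusp_sheaf: "local_dim euclidean cusp_sheaf z = 1"
  unfolding local_dim_def
proof (rule Least_equality)
  obtain r where r: "0 < r" "\<forall>w\<in>ball z r. w \<noteq> z \<longrightarrow> cusp_order w = 1"
    using cusp_order_isolated[of z] by blast
  let ?p = "cusp_order z"
  let ?x = "\<lambda>w. (w - z) ^ ?p"
  have "cusp_germ (cusp_order w) w ?x" if w: "w \<in> ball z r" for w
  proof (cases "w = z")
    case True
    have "cusp_germ ?p z ?x"
      unfolding cusp_germ_def
      by (intro exI[of _ UNIV] exI[of _ fst] conjI ballI)
        (simp_all add: cusp_map_def)
    then show ?thesis using True by simp
  next
    case False
    have "?x analytic_on {w}" by (intro analytic_intros)
    then show ?thesis
      using cusp_germ_1I[of ?x w] r(2) w False by simp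
  qed
  then have "?x \<in> cusp_sheaf (ball z r)"
    by (simp add: cusp_sheaf_def)
  moreover have "{y \<in> ball z r. \<forall>f\<in>{?x}. f y = 0} = {z}"
    using r(1) cusp_order_pos[of z] by auto
  moreover have "openin euclidean (ball z r)"
    by (rule open_openin[THEN iffD1, OF open_ball])
  ultimately show "\<exists>U F. openin euclidean U \<and> finite F \<and> card F = 1 \<and> F \<subseteq> cusp_sheaf U \<and>
      {y \<in> U. \<forall>f\<in>F. f y = 0} = {z}"
    by (intro exI[of _ "ball z r"] exI[of _ "{?x}"] conjI) simp_all
next
  fix k assume "\<exists>U F. openin euclidean U \<and> finite F \<and> card F = k \<and> F \<subseteq> cusp_sheaf U \<and>
      {y \<in> U. \<forall>f\<in>F. f y = 0} = {z}"
  then obtain U F where U: "openin euclidean U" "finite F" "card F = k" "F \<subseteq> cusp_sheaf U"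
    "{y \<in> U. \<forall>f\<in>F. f y = 0} = {z}"
    by (elim exE conjE)
  have "k \<noteq> 0"
  proof
    assume "k = 0"
    then have "F = {}" using U(2,3) by simp
    then have "U = {z}" using U(5) by simp
    then have "open {z}" using open_openin[THEN iffD2, OF U(1)] by simp
    then show False using not_open_singleton[of z] by contradiction
  qed
  then show "1 \<le> k" by simp
qed

lemma irreducible_stein_curve_cusp_sheaf: "irreducible_stein_curve euclidean cusp_sheaf"
proof -
  have "countable_at_infinity (euclidean :: complex topology)"
    unfolding countable_at_infinity_def
  proof (intro exI[of _ "\<lambda>n. cball 0 (real n)"] conjI allI)
    show "(\<Union>n. cball 0 (real n)) = topspace (euclidean :: complex topology)"
      using real_arch_simple by auto
  qed (simp add: compactin_euclidean_iff)
  moreover have "complex_dim euclidean cusp_sheaf = 1"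
    by (simp add: complex_dim_def local_dim_cusp_sheaf one_enat_def)
  ultimately show ?thesis
    unfolding irreducible_stein_curve_def stein_space_def
    by (intro conjI reduced_complex_space_cusp_sheaf holomorphically_convex_cusp_sheaf
        holomorphically_separable_cusp_sheaf irreducible_space_cusp_sheaf)
qed


section \<open>A function with simple zeros at the cusps\<close>

lemma simple_zero_power_not_cusp_germ:
  assumes "(g has_field_derivative d) (at z)" "g z = 0" "d \<noteq> 0" "1 \<le> n"
  shows "\<not> cusp_germ (Suc n) z (\<lambda>w. g w ^ n)"
proof
  assume "cusp_germ (Suc n) z (\<lambda>w. g w ^ n)"
  from cusp_germ_vanishing_order[OF this]
  have "((\<lambda>w. g w ^ n / (w - z) ^ n) \<longlongrightarrow> 0) (at z)"
    using assms(2,4) by simp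
  moreover have "((\<lambda>w. g w / (w - z)) \<longlongrightarrow> d) (at z)"
    using assms(1,2) by (simp add: has_field_derivative_iff)
  then have "((\<lambda>w. (g w / (w - z)) ^ n) \<longlongrightarrow> d ^ n) (at z)"
    by (rule tendsto_power)
  ultimately have "d ^ n = 0"
    by (intro tendsto_unique[of "at z"]) (simp_all add: power_divide)
  then show False using assms(3) by simp
qed

theorem proposition1:
  "\<exists>(X :: complex topology) (\<O> :: complex set \<Rightarrow> (complex \<Rightarrow> complex) set) (f :: complex \<Rightarrow> complex).
     irreducible_stein_curve X \<O> \<and>
     continuous_map X euclidean f \<and>
     f \<in> \<O> (topspace X - {x \<in> topspace X. f x = 0}) \<and>
     (\<forall>n\<ge>(1::nat). (\<lambda>x. f x ^ n) \<notin> \<O> (topspace X))"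
proof -
  define f where "f = (\<lambda>z :: complex. sin (of_real pi * z))"
  have zero: "f (of_nat n) = 0" for n
  proof -
    have "complex_of_real pi * of_nat n = of_real (pi * real n)" by simp
    then have "f (of_nat n) = of_real (sin (pi * real n))"
      unfolding f_def by (simp only: sin_of_real)
    then show ?thesis by simp
  qed
  have "f \<in> cusp_sheaf (UNIV - {x \<in> UNIV. f x = 0})"
    unfolding cusp_sheaf_def mem_Collect_eq
  proof
    fix z assume "z \<in> UNIV - {x \<in> UNIV. f x = 0}"
    then have "cusp_order z = 1"
      using zero cusp_order_neq_1_iff[of z] by auto
    moreover have "f analytic_on {z}"
      unfolding f_def by (intro analytic_intros)
    ultimately show "cusp_germ (cusp_order z) z f"
      using cusp_germ_1I by simp
  qed
  moreover have "continuous_on UNIV f"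
    unfolding f_def by (intro continuous_intros)
  moreover have "(\<lambda>x. f x ^ n) \<notin> cusp_sheaf UNIV" if "1 \<le> n" for n
  proof
    assume "(\<lambda>x. f x ^ n) \<in> cusp_sheaf UNIV"
    then have "\<forall>z. cusp_germ (cusp_order z) z (\<lambda>x. f x ^ n)"
      by (simp add: cusp_sheaf_def)
    from spec[OF this, of "of_nat n"]
    have germ: "cusp_germ (Suc n) (of_nat n) (\<lambda>x. f x ^ n)"
      by (simp only: cusp_order_of_nat)
    have der: "(f has_field_derivative cos (of_real pi * of_nat n) * of_real pi) (at (of_nat n))"
      unfolding f_def by (auto intro!: derivative_eq_intros)
    have "cos (of_real pi * of_nat n :: complex) * of_real pi \<noteq> 0"
      using sin_cos_squared_add[of "of_real pi * of_nat n :: complex"] zero[of n]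
      unfolding f_def by auto
    from simple_zero_power_not_cusp_germ[OF der zero this that] germ
    show False by contradiction
  qed
  ultimately show ?thesis
    using irreducible_stein_curve_cusp_sheaf
    by (intro exI[of _ euclidean] exI[of _ cusp_sheaf] exI[of _ f] conjI allI impI) simp_all
qed

end
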